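(* Let $G$ be a finite simple chordal outerplanar graph with maximum degree $\Delta$. Then $\omega(G^2) = \chi(G^2) = \Delta + 2$ if $\Delta = 4$ and $F_4$ is a subgraph of $G$, and $\omega(G^2) = \chi(G^2) = \Delta + 1$ in all other cases.
   Context: $G^2$ is the graph on $V(G)$ in which two distinct vertices are adjacent iff their distance in $G$ is 1 or 2; $\omega$ is the clique number and $\chi$ the chromatic number. $F_4$ is the 6-vertex graph obtained from a triangle $K_3$ by adding, for each of its three edges, a new vertex adjacent to both endpoints of that edge. *)

theory Defs
  imports "HOL-Analysis.Analysis" "HOL-Library.Ramsey" "HOL-Library.Extended_Nat"
begin

definition simple_graph :: "'a set \<Rightarrow> 'a set set \<Rightarrow> bool" where
  "simple_graph V E \<longleftrightarrow> finite V \<and> E \<subseteq> [V]\<^bsup>2\<^esup>"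

definition vertex_degree :: "'a set set \<Rightarrow> 'a \<Rightarrow> nat" where
  "vertex_degree E v = card {e \<in> E. v \<in> e}"

definition max_degree :: "'a set \<Rightarrow> 'a set set \<Rightarrow> nat" where
  "max_degree V E = Max (vertex_degree E ` V)"

text \<open>The least length of a walk between two vertices; it is \<open>\<infinity>\<close> if there is none.\<close>

definition graph_dist :: "'a set set \<Rightarrow> 'a \<Rightarrow> 'a \<Rightarrow> enat" where
  "graph_dist E u v = (INF n \<in> {n. (u, v) \<in> {(x, y). {x, y} \<in> E} ^^ n}. enat n)"

definition square_edges :: "'a set \<Rightarrow> 'a set set \<Rightarrow> 'a set set" where
  "square_edges V E =
     {{u, v} |u v. u \<in> V \<and> v \<in> V \<and> u \<noteq> v \<and> (graph_dist E u v = 1 \<or> graph_dist E u v = 2)}"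

definition clique_number :: "'a set \<Rightarrow> 'a set set \<Rightarrow> nat" where
  "clique_number V E = Max {card K |K. K \<subseteq> V \<and> clique K E}"

definition proper_colouring :: "'a set \<Rightarrow> 'a set set \<Rightarrow> nat \<Rightarrow> ('a \<Rightarrow> nat) \<Rightarrow> bool" where
  "proper_colouring V E k c \<longleftrightarrow>
     c ` V \<subseteq> {..<k} \<and> (\<forall>u\<in>V. \<forall>v\<in>V. {u, v} \<in> E \<longrightarrow> c u \<noteq> c v)"

definition chromatic_number :: "'a set \<Rightarrow> 'a set set \<Rightarrow> nat" where
  "chromatic_number V E = (LEAST k. \<exists>c. proper_colouring V E k c)"

text \<open>A cycle is given by the list of its vertices in cyclic order.\<close>

definition cycle_edges :: "'a list \<Rightarrow> 'a set set" where
  "cycle_edges xs = {{xs ! i, xs ! (Suc i mod length xs)} |i. i < length xs}"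

definition graph_cycle :: "'a set set \<Rightarrow> 'a list \<Rightarrow> bool" where
  "graph_cycle E xs \<longleftrightarrow> 3 \<le> length xs \<and> distinct xs \<and> cycle_edges xs \<subseteq> E"

definition chordal :: "'a set set \<Rightarrow> bool" where
  "chordal E \<longleftrightarrow>
     (\<forall>xs. graph_cycle E xs \<and> 4 \<le> length xs \<longrightarrow> (\<exists>e\<in>E. e \<subseteq> set xs \<and> e \<notin> cycle_edges xs))"

text \<open>
  A drawing places the vertices at distinct points \<open>p v\<close> of the plane and draws every edge \<open>e\<close>
  as an arc \<open>\<gamma> e\<close> joining the positions of its ends. Arcs meet each other and the vertex
  positions in common ends only.
\<close>

definition plane_drawing ::
    "'a set \<Rightarrow> 'a set set \<Rightarrow> ('a \<Rightarrow> complex) \<Rightarrow> ('a set \<Rightarrow> real \<Rightarrow> complex) \<Rightarrow> bool" where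
  "plane_drawing V E p \<gamma> \<longleftrightarrow>
     inj_on p V \<and>
     (\<forall>e\<in>E. arc (\<gamma> e) \<and> {pathstart (\<gamma> e), pathfinish (\<gamma> e)} = p ` e) \<and>
     (\<forall>e\<in>E. path_image (\<gamma> e) \<inter> p ` V = p ` e) \<and>
     (\<forall>e\<in>E. \<forall>f\<in>E. e \<noteq> f \<longrightarrow> path_image (\<gamma> e) \<inter> path_image (\<gamma> f) \<subseteq> p ` V)"

definition drawing_image ::
    "'a set \<Rightarrow> 'a set set \<Rightarrow> ('a \<Rightarrow> complex) \<Rightarrow> ('a set \<Rightarrow> real \<Rightarrow> complex) \<Rightarrow> complex set" where
  "drawing_image V E p \<gamma> = p ` V \<union> (\<Union>e\<in>E. path_image (\<gamma> e))"

text \<open>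
  For a finite graph the drawing is compact, so \<^const>\<open>outside\<close> of it is its unique unbounded face.
\<close>

definition outerplanar :: "'a set \<Rightarrow> 'a set set \<Rightarrow> bool" where
  "outerplanar V E \<longleftrightarrow>
     (\<exists>p \<gamma>. plane_drawing V E p \<gamma> \<and>
            (\<forall>v\<in>V. p v \<in> frontier (outside (drawing_image V E p \<gamma>))))"

text \<open>Subgraph containment up to isomorphism; the copy need not be induced.\<close>

definition contains_subgraph ::
    "'a set \<Rightarrow> 'a set set \<Rightarrow> 'b set \<Rightarrow> 'b set set \<Rightarrow> bool" where
  "contains_subgraph V E W F \<longleftrightarrow>
     (\<exists>h. inj_on h W \<and> h ` W \<subseteq> V \<and> (\<forall>e\<in>F. h ` e \<in> E))"

definition F4_verts :: "nat set" where
  "F4_verts = {0, 1, 2, 3, 4, 5}"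

text \<open>The triangle is on 0, 1, 2; the vertices 3, 4, 5 are attached to its three edges.\<close>

definition F4_edges :: "nat set set" where
  "F4_edges = {{0, 1}, {1, 2}, {0, 2},
               {3, 0}, {3, 1}, {4, 1}, {4, 2}, {5, 0}, {5, 2}}"

end

theory Submission
  imports Defs
begin

text \<open>
  No vertex of an outerplanar drawing lies inside a cycle, while one of the three paths of a
  \<open>\<theta>\<close>-curve runs inside the cycle formed by the other two. Hence an outerplanar graph has no \<open>K\<^sub>4\<close>
  and no edge in three triangles; besides chordality this is all that is used. A largest closed
  neighbourhood, or \<open>F\<^sub>4\<close>, is a clique of the square, so it remains to colour the square with
  \<open>k\<close> colours, \<open>k > \<Delta>\<close>, assuming that there is no \<open>F\<^sub>4\<close> if \<open>k = 5\<close>.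

  In a minimal counterexample take a vertex \<open>v\<close> of largest depth in a perfect elimination ordering.
  If its second neighbourhood is contained in a closed neighbourhood then \<open>v\<close> can be coloured last.
  Otherwise \<open>v\<close> lies in a fork: a triangle \<open>u w x\<close> such that the only other neighbours of \<open>u\<close> are
  vertices \<open>v\<close>, \<open>v'\<close> of degree 2 attached to \<open>u w\<close> and \<open>u x\<close>. A colouring of the rest extends to
  \<open>v\<close> and \<open>v'\<close> unless \<open>w\<close> and \<open>x\<close> both have degree \<open>k - 1\<close> and see the same colours. As \<open>v\<close> is
  deepest, one of \<open>w\<close>, \<open>x\<close> has degree at most 6, and the few remaining cases are settled by
  recolouring.
\<close>

section \<open>Outerplanar drawings\<close>

text \<open>Deleting a vertex may destroy paths of length 2, and then a colouring of the smaller
  square need not respect all old conflicts. Simplicial vertices can be deleted safely, since their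
  neighbours are adjacent anyway. A fork is where colouring \<open>v\<close> last fails:
  \<open>v\<close> conflicts with the closed neighbourhood of \<open>w\<close> and also with
  \<open>v'\<close>, which can amount to \<open>k\<close> vertices. The bound 6 arises as follows.
  Let \<open>x\<close> be the end of the fork of larger rank. It has rank exactly one less than
  \<open>u\<close>, and nothing is deeper than \<open>v\<close>, so the neighbours of
  \<open>x\<close> are lower than \<open>x\<close> or one or two levels deeper. At most two are
  lower, the deeper ones sit in triangles on few edges, and an edge carries at most two triangles.
  This leaves degrees 3 to 6 for \<open>x\<close>. This degree has to be \<open>k - 1\<close>.
  Degree 3 is too small because \<open>u\<close> has degree 4. Degree 4 means \<open>k = 5\<close>
  and produces an \<open>F_4\<close>, which is how the exception enters: \<open>F_4\<close> has
  maximum degree 4, but its square is complete on six vertices.\<close>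

lemma Jordan_arc_pair:
  fixes c1 c2 :: "real \<Rightarrow> complex"
  assumes "arc c1" "pathstart c1 = a" "pathfinish c1 = b"
    and "arc c2" "pathstart c2 = a" "pathfinish c2 = b"
    and "path_image c1 \<inter> path_image c2 = {a, b}"
  shows "inside (path_image c1 \<union> path_image c2) \<noteq> {}"
    and "connected (inside (path_image c1 \<union> path_image c2))"
    and "connected (outside (path_image c1 \<union> path_image c2))"
    and "frontier (inside (path_image c1 \<union> path_image c2)) = path_image c1 \<union> path_image c2"
proof -
  let ?c = "c1 +++ reversepath c2"
  have "simple_path ?c"
    using assms by (intro simple_path_join_loop) (auto simp: arc_reversepath)
  moreover have "pathfinish ?c = pathstart ?c" using assms by simp
  moreover have "path_image ?c = path_image c1 \<union> path_image c2"
    using assms by (subst path_image_join) auto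
  ultimately show "inside (path_image c1 \<union> path_image c2) \<noteq> {}"
    and "connected (inside (path_image c1 \<union> path_image c2))"
    and "connected (outside (path_image c1 \<union> path_image c2))"
    and "frontier (inside (path_image c1 \<union> path_image c2)) = path_image c1 \<union> path_image c2"
    using Jordan_inside_outside[of ?c] by auto
qed

lemma connected_inside_or_outside:
  fixes S :: "complex set"
  assumes "closed S" "connected X" "X \<inter> S = {}"
  shows "X \<subseteq> inside S \<or> X \<subseteq> outside S"
proof -
  have "X \<subseteq> inside S \<union> outside S" using assms inside_Un_outside[of S] by auto
  moreover have "open (inside S)" "open (outside S)"
    using assms by (auto intro: open_inside open_outside)
  moreover have "inside S \<inter> outside S \<inter> X = {}"
    by (simp add: inside_Int_outside)
  ultimately show ?thesis
    using connectedD[OF assms(2), of "inside S" "outside S"] by blast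
qed

text \<open>Suppose every open arc lies outside the cycle of the other two. The single points
  \<open>m1\<close> and \<open>m2\<close> fix the side of the open arcs \<open>c1\<close> and
  \<open>c2\<close>, as these are connected; in the applications they are vertices. The region
  \<open>I\<close> inside \<open>c1\<close> and \<open>c2\<close> then lies outside both cycles
  through \<open>c3\<close>, and Janiszewski's theorem connects it to the unbounded face without
  crossing \<open>c1\<close> or \<open>c2\<close>, which is absurd.\<close>

lemma theta_curve_inside:
  fixes c1 c2 c3 :: "real \<Rightarrow> complex"
  assumes c1: "arc c1" "pathstart c1 = a" "pathfinish c1 = b"
    and c2: "arc c2" "pathstart c2 = a" "pathfinish c2 = b"
    and c3: "arc c3" "pathstart c3 = a" "pathfinish c3 = b"
    and i12: "path_image c1 \<inter> path_image c2 = {a, b}"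
    and i13: "path_image c1 \<inter> path_image c3 = {a, b}"
    and i23: "path_image c2 \<inter> path_image c3 = {a, b}"
    and m1: "m1 \<in> path_image c1 - {a, b}" "m1 \<notin> inside (path_image c2 \<union> path_image c3)"
    and m2: "m2 \<in> path_image c2 - {a, b}" "m2 \<notin> inside (path_image c1 \<union> path_image c3)"
  shows "path_image c3 - {a, b} \<subseteq> inside (path_image c1 \<union> path_image c2)"
proof (rule ccontr)
  let ?C1 = "path_image c1" and ?C2 = "path_image c2" and ?C3 = "path_image c3"
  assume not_in: "\<not> ?C3 - {a, b} \<subseteq> inside (?C1 \<union> ?C2)"
  have compact: "compact ?C1" "compact ?C2" "compact ?C3"
    using c1 c2 c3 by (auto intro: compact_arc_image)
  have closed: "closed (?C1 \<union> ?C2)" "closed (?C1 \<union> ?C3)" "closed (?C2 \<union> ?C3)"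
    using compact by (auto intro!: closed_Un compact_imp_closed)
  have conn: "connected (?C1 - {a, b})" "connected (?C2 - {a, b})" "connected (?C3 - {a, b})"
    using connected_simple_path_endless[OF arc_imp_simple_path] c1 c2 c3 by metis+
  have out1: "?C1 - {a, b} \<subseteq> outside (?C2 \<union> ?C3)"
    using connected_inside_or_outside[OF closed(3) conn(1)] i12 i13 m1 by blast
  have out2: "?C2 - {a, b} \<subseteq> outside (?C1 \<union> ?C3)"
    using connected_inside_or_outside[OF closed(2) conn(2)] i12 i23 m2 by blast
  have out3: "?C3 - {a, b} \<subseteq> outside (?C1 \<union> ?C2)"
    using connected_inside_or_outside[OF closed(1) conn(3)] i13 i23 not_in by blast
  define I where "I = inside (?C1 \<union> ?C2)"
  note J12 = Jordan_arc_pair[OF c1 c2 i12, folded I_def]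
  have I_disj: "I \<inter> (?C1 \<union> ?C2) = {}" unfolding I_def by (simp add: inside_no_overlap)
  have ab: "a \<in> ?C1" "b \<in> ?C1" using c1 by (metis pathstart_in_path_image pathfinish_in_path_image)+
  have I3: "I \<inter> ?C3 = {}"
    using out3 I_disj ab inside_Int_outside[of "?C1 \<union> ?C2"] unfolding I_def by blast
  \<comment> \<open>Every point of the cycle is a limit of \<open>I\<close>, so the open outside of
    another cycle meets \<open>I\<close> as soon as it contains \<open>m1\<close> or
    \<open>m2\<close>. Connectedness then puts all of \<open>I\<close> there.\<close>
  have meets: "I \<inter> U \<noteq> {}" if "open U" "m \<in> U" "m \<in> ?C1 \<union> ?C2" for U m
  proof -
    have "m \<in> closure I" using J12(4) that by (auto simp: frontier_def)
    then show ?thesis using that open_Int_closure_eq_empty[of U I] by blast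
  qed
  have I13: "I \<subseteq> outside (?C1 \<union> ?C3)"
  proof -
    have "I \<inter> outside (?C1 \<union> ?C3) \<noteq> {}"
      using meets[of _ m2] m2 out2 closed by (simp add: open_outside subset_iff)
    then show ?thesis
      using connected_inside_or_outside[OF closed(2) J12(2)] I_disj I3
        inside_Int_outside[of "?C1 \<union> ?C3"] by blast
  qed
  have I23: "I \<subseteq> outside (?C2 \<union> ?C3)"
  proof -
    have "I \<inter> outside (?C2 \<union> ?C3) \<noteq> {}"
      using meets[of _ m1] m1 out1 closed by (simp add: open_outside subset_iff)
    then show ?thesis
      using connected_inside_or_outside[OF closed(3) J12(2)] I_disj I3
        inside_Int_outside[of "?C2 \<union> ?C3"] by blast
  qed
  obtain x where x: "x \<in> I" using J12(1) by blast
  have "bounded (?C1 \<union> ?C2 \<union> ?C3)" using compact by (simp add: compact_imp_bounded)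
  then have "outside (?C1 \<union> ?C2 \<union> ?C3) \<noteq> {}"
    by (metis outside_bounded_nonempty)
  then obtain y where y: "y \<in> outside (?C1 \<union> ?C2 \<union> ?C3)" by blast
  have y13: "y \<in> outside (?C1 \<union> ?C3)" and y23: "y \<in> outside (?C2 \<union> ?C3)"
    and y12: "y \<in> outside (?C1 \<union> ?C2)"
    using y outside_mono[of _ "?C1 \<union> ?C2 \<union> ?C3"] by blast+
  have cc: "connected_component (- S) x y"
    if "connected (outside S)" "x \<in> outside S" "y \<in> outside S" for S :: "complex set"
    using that unfolding connected_component_def
    by (metis (no_types) disjoint_eq_subset_Compl outside_no_overlap inf_commute)
  \<comment> \<open>The two closed curves through \<open>c3\<close> meet in the connected set \<open>c3\<close> and neither of them
    separates \<open>x\<close> from \<open>y\<close>, hence neither does their union.\<close>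
  have "connected_component (- ((?C1 \<union> ?C3) \<union> (?C2 \<union> ?C3))) x y"
  proof (rule Janiszewski)
    have "(?C1 \<union> ?C3) \<inter> (?C2 \<union> ?C3) = ?C3" using i12 i13 ab by blast
    then show "connected ((?C1 \<union> ?C3) \<inter> (?C2 \<union> ?C3))"
      using c3 by (simp add: connected_arc_image)
    show "connected_component (- (?C1 \<union> ?C3)) x y"
      using cc Jordan_arc_pair(3)[OF c1 c3 i13] x I13 y13 by blast
    show "connected_component (- (?C2 \<union> ?C3)) x y"
      using cc Jordan_arc_pair(3)[OF c2 c3 i23] x I23 y23 by blast
  qed (use compact closed in \<open>auto\<close>)
  then have "connected_component (- (?C1 \<union> ?C2)) x y"
    by (rule connected_component_of_subset) blast
  moreover have "x \<in> inside (?C1 \<union> ?C2)" using x unfolding I_def .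
  ultimately have "y \<in> inside (?C1 \<union> ?C2)"
    using inside_same_component by (metis mem_Collect_eq)
  then show False using y12 inside_Int_outside[of "?C1 \<union> ?C2"] by blast
qed

section \<open>Cycles and paths in an outerplanar drawing\<close>

locale outerplane_drawing =
  fixes V :: "'a set" and E :: "'a set set" and p :: "'a \<Rightarrow> complex"
    and \<gamma> :: "'a set \<Rightarrow> real \<Rightarrow> complex"
  assumes graph: "simple_graph V E"
    and drawing: "plane_drawing V E p \<gamma>"
    and outer: "v \<in> V \<Longrightarrow> p v \<in> frontier (outside (drawing_image V E p \<gamma>))"
begin

abbreviation edge_image :: "'a \<Rightarrow> 'a \<Rightarrow> complex set" where
  "edge_image a b \<equiv> path_image (\<gamma> {a, b})"

lemma edge_ends: "{a, b} \<in> E \<Longrightarrow> a \<in> V \<and> b \<in> V \<and> a \<noteq> b"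
  using graph unfolding simple_graph_def by (metis doubleton_in_nsets_2 subsetD)

lemma p_eq_iff: "a \<in> V \<Longrightarrow> b \<in> V \<Longrightarrow> p a = p b \<longleftrightarrow> a = b"
  using drawing by (auto simp: plane_drawing_def inj_on_def)

lemma edge_image_vertices: "{a, b} \<in> E \<Longrightarrow> edge_image a b \<inter> p ` V = {p a, p b}"
  using drawing by (auto simp: plane_drawing_def)

lemma vertex_in_edge_image:
  "{a, b} \<in> E \<Longrightarrow> v \<in> V \<Longrightarrow> p v \<in> edge_image a b \<longleftrightarrow> v = a \<or> v = b"
proof -
  assume "{a, b} \<in> E" "v \<in> V"
  then have "p v \<in> edge_image a b \<longleftrightarrow> p v \<in> {p a, p b}"
    using edge_image_vertices[of a b] by blast
  then show ?thesis
    using edge_ends[of a b] p_eq_iff[of v a] p_eq_iff[of v b] \<open>v \<in> V\<close> \<open>{a, b} \<in> E\<close> by simp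
qed

lemma edge_images_Int:
  assumes "{a, b} \<in> E" "{c, d} \<in> E" "{a, b} \<noteq> {c, d}"
  shows "edge_image a b \<inter> edge_image c d = p ` ({a, b} \<inter> {c, d})"
proof -
  have "edge_image a b \<inter> edge_image c d \<subseteq> p ` V"
    using drawing assms by (simp add: plane_drawing_def)
  then have "edge_image a b \<inter> edge_image c d = {p a, p b} \<inter> {p c, p d}"
    using edge_image_vertices[OF assms(1)] edge_image_vertices[OF assms(2)] by blast
  also have "\<dots> = p ` ({a, b} \<inter> {c, d})"
    using edge_ends[OF assms(1)] edge_ends[OF assms(2)] by (auto simp: p_eq_iff)
  finally show ?thesis .
qed

lemma edge_arc:
  assumes "{a, b} \<in> E"
  obtains g where "arc g" "pathstart g = p a" "pathfinish g = p b" "path_image g = edge_image a b"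
proof -
  have g: "arc (\<gamma> {a, b})" "{pathstart (\<gamma> {a, b}), pathfinish (\<gamma> {a, b})} = {p a, p b}"
    using drawing assms by (auto simp: plane_drawing_def)
  then consider "pathstart (\<gamma> {a, b}) = p a" "pathfinish (\<gamma> {a, b}) = p b"
    | "pathstart (\<gamma> {a, b}) = p b" "pathfinish (\<gamma> {a, b}) = p a"
    by (auto simp: doubleton_eq_iff)
  then show ?thesis
  proof cases
    case 1 then show ?thesis using that g by blast
  next
    case 2 then show ?thesis using that[of "reversepath (\<gamma> {a, b})"] g by (simp add: arc_reversepath)
  qed
qed

lemma two_edge_arc:
  assumes "{a, c} \<in> E" "{c, b} \<in> E" "a \<noteq> b"
  obtains g where "arc g" "pathstart g = p a" "pathfinish g = p b"
    "path_image g = edge_image a c \<union> edge_image c b"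
proof -
  obtain g1 where g1: "arc g1" "pathstart g1 = p a" "pathfinish g1 = p c"
    "path_image g1 = edge_image a c" using edge_arc assms by metis
  obtain g2 where g2: "arc g2" "pathstart g2 = p c" "pathfinish g2 = p b"
    "path_image g2 = edge_image c b" using edge_arc assms by metis
  have "edge_image a c \<inter> edge_image c b = p ` ({a, c} \<inter> {c, b})"
    using assms by (intro edge_images_Int) (auto simp: doubleton_eq_iff)
  then have "arc (g1 +++ g2)"
    using g1 g2 assms edge_ends by (intro arc_join) auto
  moreover have "path_image (g1 +++ g2) = edge_image a c \<union> edge_image c b"
    using g1 g2 by (simp add: path_image_join)
  ultimately show ?thesis using that g1 g2 by simp
qed

text \<open>A vertex is a limit of the unbounded face of the whole drawing, and this face lies
  outside every part \<open>S\<close> of the drawing.\<close>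

lemma vertex_not_inside:
  assumes "v \<in> V" "closed S" "S \<subseteq> drawing_image V E p \<gamma>"
  shows "p v \<notin> inside S"
proof
  assume "p v \<in> inside S"
  moreover have "open (inside S)" using assms by (simp add: open_inside)
  moreover have "p v \<in> closure (outside (drawing_image V E p \<gamma>))"
    using outer[OF assms(1)] by (simp add: frontier_def)
  ultimately have "inside S \<inter> outside (drawing_image V E p \<gamma>) \<noteq> {}"
    using open_Int_closure_eq_empty[of "inside S"] by blast
  then show False
    using outside_mono[OF assms(3)] inside_Int_outside[of S] by blast
qed

lemma edge_image_subset: "{a, b} \<in> E \<Longrightarrow> edge_image a b \<subseteq> drawing_image V E p \<gamma>"
  unfolding drawing_image_def by blast

lemma closed_edge_image: "{a, b} \<in> E \<Longrightarrow> closed (edge_image a b)"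
  using drawing by (auto simp: plane_drawing_def intro: closed_arc_image)

lemma edge_image_commute: "edge_image a b = edge_image b a"
  by (simp add: insert_commute)

lemma two_edge_images_Int:
  assumes "{a, c} \<in> E" "{c, b} \<in> E" "{a, d} \<in> E" "{d, b} \<in> E" "a \<noteq> b" "c \<noteq> d"
  shows "(edge_image a c \<union> edge_image c b) \<inter> (edge_image a d \<union> edge_image d b) = {p a, p b}"
proof -
  have "edge_image a c \<inter> edge_image a d = p ` ({a, c} \<inter> {a, d})"
    "edge_image a c \<inter> edge_image d b = p ` ({a, c} \<inter> {d, b})"
    "edge_image c b \<inter> edge_image a d = p ` ({c, b} \<inter> {a, d})"
    "edge_image c b \<inter> edge_image d b = p ` ({c, b} \<inter> {d, b})"
    using assms edge_ends by (intro edge_images_Int; auto simp: doubleton_eq_iff)+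
  then show ?thesis
    using assms edge_ends unfolding Int_Un_distrib Int_Un_distrib2 by auto
qed

lemma two_edge_image_Int_edge_image:
  assumes "{a, b} \<in> E" "{a, c} \<in> E" "{c, b} \<in> E"
  shows "(edge_image a c \<union> edge_image c b) \<inter> edge_image a b = {p a, p b}"
proof -
  have "edge_image a c \<inter> edge_image a b = p ` ({a, c} \<inter> {a, b})"
    "edge_image c b \<inter> edge_image a b = p ` ({c, b} \<inter> {a, b})"
    using assms edge_ends by (intro edge_images_Int; auto simp: doubleton_eq_iff)+
  then show ?thesis using assms edge_ends unfolding Int_Un_distrib2 by auto
qed

text \<open>The three paths form a theta-curve. Since \<open>c1\<close> and \<open>c2\<close> lie
  inside no cycle, the third path runs inside the cycle of the other two and takes the vertex
  \<open>c3\<close> with it. This excludes the complete bipartite graph on 2 and 3 vertices, whether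
  or not \<open>a\<close> and \<open>b\<close> are adjacent.\<close>

theorem no_three_common_neighbours:
  assumes "{a, c1} \<in> E" "{c1, b} \<in> E" "{a, c2} \<in> E" "{c2, b} \<in> E" "{a, c3} \<in> E" "{c3, b} \<in> E"
    and "a \<noteq> b" "c1 \<noteq> c2" "c1 \<noteq> c3" "c2 \<noteq> c3"
  shows False
proof -
  let ?P = "\<lambda>c. edge_image a c \<union> edge_image c b"
  obtain g1 where g1: "arc g1" "pathstart g1 = p a" "pathfinish g1 = p b" "path_image g1 = ?P c1"
    using two_edge_arc assms by metis
  obtain g2 where g2: "arc g2" "pathstart g2 = p a" "pathfinish g2 = p b" "path_image g2 = ?P c2"
    using two_edge_arc assms by metis
  obtain g3 where g3: "arc g3" "pathstart g3 = p a" "pathfinish g3 = p b" "path_image g3 = ?P c3"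
    using two_edge_arc assms by metis
  have mem: "p c \<in> ?P c - {p a, p b}" if "{a, c} \<in> E" "{c, b} \<in> E" for c
    using that edge_ends vertex_in_edge_image p_eq_iff by blast
  have not_in: "p v \<notin> inside (?P c \<union> ?P d)"
    if "{a, c} \<in> E" "{c, b} \<in> E" "{a, d} \<in> E" "{d, b} \<in> E" "v \<in> V" for c d v
    using that closed_edge_image edge_image_subset
    by (intro vertex_not_inside) (auto intro!: closed_Un)
  have "path_image g3 - {p a, p b} \<subseteq> inside (path_image g1 \<union> path_image g2)"
    using g1 g2 g3 mem[of c1] mem[of c2] not_in[of c2 c3 c1] not_in[of c1 c3 c2] assms edge_ends
    by (intro theta_curve_inside[where ?m1.0 = "p c1" and ?m2.0 = "p c2"])
      (simp_all add: two_edge_images_Int)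
  then show False
    using mem[of c3] not_in[of c1 c2 c3] g1 g2 g3 assms edge_ends by auto
qed

text \<open>The third arc of the theta-curve is now a single edge, with no vertex in its interior,
  so that running inside is no contradiction by itself.\<close>

lemma edge_inside_two_triangles:
  assumes "{a, b} \<in> E" "{a, c} \<in> E" "{c, b} \<in> E" "{a, d} \<in> E" "{d, b} \<in> E" "c \<noteq> d"
  shows "edge_image a b - {p a, p b}
    \<subseteq> inside ((edge_image a c \<union> edge_image c b) \<union> (edge_image a d \<union> edge_image d b))"
proof -
  let ?P = "\<lambda>c. edge_image a c \<union> edge_image c b"
  have ne: "a \<noteq> b" using assms edge_ends by blast
  obtain g1 where g1: "arc g1" "pathstart g1 = p a" "pathfinish g1 = p b" "path_image g1 = ?P c"
    using two_edge_arc assms ne by metis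
  obtain g2 where g2: "arc g2" "pathstart g2 = p a" "pathfinish g2 = p b" "path_image g2 = ?P d"
    using two_edge_arc assms ne by metis
  obtain g3 where g3: "arc g3" "pathstart g3 = p a" "pathfinish g3 = p b"
    "path_image g3 = edge_image a b"
    using edge_arc assms by metis
  have mem: "p c \<in> ?P c - {p a, p b}" if "{a, c} \<in> E" "{c, b} \<in> E" for c
    using that edge_ends vertex_in_edge_image p_eq_iff by blast
  have not_in: "p v \<notin> inside (?P c \<union> edge_image a b)"
    if "{a, c} \<in> E" "{c, b} \<in> E" "v \<in> V" for c v
    using that assms closed_edge_image edge_image_subset
    by (intro vertex_not_inside) (auto intro!: closed_Un)
  note int = two_edge_image_Int_edge_image[OF assms(1)]
  have "path_image g3 - {p a, p b} \<subseteq> inside (path_image g1 \<union> path_image g2)"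
    using g1 g2 g3 mem[of c] mem[of d] not_in[of d c] not_in[of c d] int assms edge_ends ne
    by (intro theta_curve_inside[where ?m1.0 = "p c" and ?m2.0 = "p d"])
      (simp_all add: two_edge_images_Int)
  then show ?thesis using g1 g2 g3 by simp
qed

text \<open>Both diagonals \<open>{a, b}\<close> and \<open>{c, d}\<close> of the 4-cycle
  \<open>a, c, b, d\<close> run inside it. The first cuts the inside into the insides of the
  triangles at \<open>c\<close> and at \<open>d\<close>. The second avoids the first, so it stays in
  one of the two pieces; but it has both \<open>c\<close> and \<open>d\<close> as limits, and the
  one that is not a corner of that triangle would be inside it.\<close>

theorem no_K4:
  assumes ab: "{a, b} \<in> E" and ac: "{a, c} \<in> E" and ad: "{a, d} \<in> E"
    and bc: "{b, c} \<in> E" and bd: "{b, d} \<in> E" and cd: "{c, d} \<in> E"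
  shows False
proof -
  let ?P = "\<lambda>c. edge_image a c \<union> edge_image c b"
  have cb: "{c, b} \<in> E" and db: "{d, b} \<in> E" and da: "{d, a} \<in> E" and ca: "{c, a} \<in> E"
    using assms by (simp_all add: insert_commute)
  have ne: "a \<noteq> b" "a \<noteq> c" "a \<noteq> d" "b \<noteq> c" "b \<noteq> d" "c \<noteq> d"
    and V: "a \<in> V" "b \<in> V" "c \<in> V" "d \<in> V"
    using assms edge_ends by blast+
  obtain g1 where g1: "arc g1" "pathstart g1 = p a" "pathfinish g1 = p b" "path_image g1 = ?P c"
    using two_edge_arc ac cb ne by metis
  obtain g2 where g2: "arc g2" "pathstart g2 = p a" "pathfinish g2 = p b" "path_image g2 = ?P d"
    using two_edge_arc ad db ne by metis
  obtain g where g: "arc g" "pathstart g = p a" "pathfinish g = p b"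
    "path_image g = edge_image a b"
    using edge_arc ab by metis
  obtain h where h: "arc h" "pathstart h = p c" "pathfinish h = p d"
    "path_image h = edge_image c d"
    using edge_arc cd by metis
  note int = two_edge_image_Int_edge_image[OF ab]
  have in_ab: "edge_image a b - {p a, p b} \<subseteq> inside (?P c \<union> ?P d)"
    using edge_inside_two_triangles ab ac cb ad db ne by blast
  have in_cd: "edge_image c d - {p c, p d} \<subseteq> inside (?P c \<union> ?P d)"
  proof -
    have "(edge_image c a \<union> edge_image a d) \<union> (edge_image c b \<union> edge_image b d) = ?P c \<union> ?P d"
      using edge_image_commute by blast
    then show ?thesis
      using edge_inside_two_triangles[of c d a b] cd ca ad cb bd ne by simp
  qed
  have nonempty: "edge_image a b \<inter> inside (?P c \<union> ?P d) \<noteq> {}"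
  proof -
    have "edge_image a b - {p a, p b} \<noteq> {}"
      using nonempty_simple_path_endless[OF arc_imp_simple_path[OF g(1)]] g by simp
    then show ?thesis using in_ab by blast
  qed
  have split: "inside (?P c \<union> edge_image a b) \<inter> inside (?P d \<union> edge_image a b) = {}"
    "inside (?P c \<union> edge_image a b) \<union> inside (?P d \<union> edge_image a b) \<union> (edge_image a b - {p a, p b})
      = inside (?P c \<union> ?P d)"
    by (rule split_inside_simple_closed_curve[of g1 "p a" "p b" g2 g];
        use g1 g2 g int ac cb ad db ne V nonempty p_eq_iff in
          \<open>simp add: arc_imp_simple_path two_edge_images_Int\<close>)+
  have "edge_image c d \<inter> edge_image a b = p ` ({c, d} \<inter> {a, b})"
    using cd ab ne by (intro edge_images_Int) (auto simp: doubleton_eq_iff)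
  then have disj: "edge_image c d \<inter> edge_image a b = {}" using ne by auto
  have conn: "connected (edge_image c d - {p c, p d})"
    using connected_simple_path_endless[OF arc_imp_simple_path[OF h(1)]] h by simp
  have cl: "closed (?P c \<union> edge_image a b)" "closed (?P d \<union> edge_image a b)"
    using closed_edge_image ab ac cb ad db by (auto intro!: closed_Un)
  have sub: "?P c \<union> edge_image a b \<subseteq> drawing_image V E p \<gamma>"
    "?P d \<union> edge_image a b \<subseteq> drawing_image V E p \<gamma>"
    using edge_image_subset ab ac cb ad db by blast+
  have ends: "p c \<in> closure (edge_image c d - {p c, p d})" "p d \<in> closure (edge_image c d - {p c, p d})"
  proof -
    have "connected (edge_image c d)" using h by (metis connected_arc_image)
    moreover have "p c \<in> edge_image c d" "p d \<in> edge_image c d"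
      using vertex_in_edge_image cd V by blast+
    moreover have "p c \<noteq> p d" using p_eq_iff V ne by blast
    ultimately have "p c islimpt edge_image c d" "p d islimpt edge_image c d"
      by (metis connected_imp_perfect insertE insert_absorb empty_iff singletonD)+
    then have "p c islimpt edge_image c d - {p c, p d}" "p d islimpt edge_image c d - {p c, p d}"
      using islimpt_Un_finite[of "{p c, p d}" _ "edge_image c d - {p c, p d}"]
      by (simp_all add: islimpt_insert)
    then show "p c \<in> closure (edge_image c d - {p c, p d})"
      "p d \<in> closure (edge_image c d - {p c, p d})"
      by (simp_all add: closure_def)
  qed
  have "edge_image c d - {p c, p d} \<subseteq> inside (?P c \<union> edge_image a b) \<union> inside (?P d \<union> edge_image a b)"
    using in_cd split(2) disj by blast
  then have "edge_image c d - {p c, p d} \<subseteq> inside (?P c \<union> edge_image a b)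
    \<or> edge_image c d - {p c, p d} \<subseteq> inside (?P d \<union> edge_image a b)"
    using connectedD[OF conn, of "inside (?P c \<union> edge_image a b)" "inside (?P d \<union> edge_image a b)"]
      open_inside[OF cl(1)] open_inside[OF cl(2)] split(1) by blast
  then show False
  proof
    assume "edge_image c d - {p c, p d} \<subseteq> inside (?P c \<union> edge_image a b)"
    then have "p d \<in> closure (inside (?P c \<union> edge_image a b))" using ends closure_mono by blast
    then have "p d \<in> inside (?P c \<union> edge_image a b)"
      using closure_inside_subset[OF cl(1)] vertex_in_edge_image ab ac cb ne V by blast
    then show False using vertex_not_inside[OF V(4) cl(1) sub(1)] by blast
  next
    assume "edge_image c d - {p c, p d} \<subseteq> inside (?P d \<union> edge_image a b)"
    then have "p c \<in> closure (inside (?P d \<union> edge_image a b))" using ends closure_mono by blast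
    then have "p c \<in> inside (?P d \<union> edge_image a b)"
      using closure_inside_subset[OF cl(2)] vertex_in_edge_image ab ad db ne V by blast
    then show False using vertex_not_inside[OF V(3) cl(2) sub(2)] by blast
  qed
qed

end

section \<open>Perfect elimination orderings\<close>

text \<open>
  The assumption \<open>cone\<close> is chordality for the cycle that closes a shortest path from \<open>s\<close> to \<open>t\<close>
  through \<open>Z\<close> by the vertex \<open>w\<close>; in this form it is inherited by induced subgraphs.
\<close>

locale chordal_outerplanar_relation =
  fixes adj :: "'a \<Rightarrow> 'a \<Rightarrow> bool"
  assumes sym: "adj a b \<Longrightarrow> adj b a"
    and irrefl: "\<not> adj a a"
    and cone: "\<lbrakk>adj w s; adj w t; s \<noteq> t; \<forall>z\<in>Z. z \<noteq> w \<and> \<not> adj w z; adj s a; adj t b; a \<in> Z;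
      (a, b) \<in> {(x, y). x \<in> Z \<and> y \<in> Z \<and> adj x y}\<^sup>*\<rbrakk> \<Longrightarrow> adj s t"
    and no_K4: "\<lbrakk>adj a b; adj a c; adj a d; adj b c; adj b d; adj c d\<rbrakk> \<Longrightarrow> False"
    and no_book: "\<lbrakk>adj a x; adj b x; adj a y; adj b y; adj a z; adj b z; adj a b;
      x \<noteq> y; x \<noteq> z; y \<noteq> z\<rbrakk> \<Longrightarrow> False"
begin

definition nbrs :: "'a set \<Rightarrow> 'a \<Rightarrow> 'a set" where
  "nbrs W v = {u \<in> W. adj v u}"

definition simplicial :: "'a set \<Rightarrow> 'a \<Rightarrow> bool" where
  "simplicial W v \<longleftrightarrow> v \<in> W \<and> (\<forall>a\<in>nbrs W v. \<forall>b\<in>nbrs W v. a \<noteq> b \<longrightarrow> adj a b)"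

text \<open>The middle vertex has to lie in \<open>W\<close>: what is coloured is the square of the
  subgraph induced by \<open>W\<close>, not the subgraph that \<open>W\<close> induces in the
  square. Shrinking \<open>W\<close> can therefore remove conflicts.\<close>

definition square_colouring :: "'a set \<Rightarrow> nat \<Rightarrow> ('a \<Rightarrow> nat) \<Rightarrow> bool" where
  "square_colouring W k c \<longleftrightarrow> (\<forall>u\<in>W. c u < k) \<and>
     (\<forall>u\<in>W. \<forall>v\<in>W. u \<noteq> v \<and> (adj u v \<or> (\<exists>z\<in>W. adj u z \<and> adj z v)) \<longrightarrow> c u \<noteq> c v)"

lemma sym_rtrancl_adj:
  "(a, b) \<in> {(x, y). x \<in> Z \<and> y \<in> Z \<and> adj x y}\<^sup>* \<Longrightarrow> (b, a) \<in> {(x, y). x \<in> Z \<and> y \<in> Z \<and> adj x y}\<^sup>*"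
proof -
  have "sym ({(x, y). x \<in> Z \<and> y \<in> Z \<and> adj x y}\<^sup>*)"
    by (intro sym_rtrancl symI) (auto intro: sym)
  then show "(a, b) \<in> {(x, y). x \<in> Z \<and> y \<in> Z \<and> adj x y}\<^sup>* \<Longrightarrow> (b, a) \<in> {(x, y). x \<in> Z \<and> y \<in> Z \<and> adj x y}\<^sup>*"
    by (rule symD)
qed

text \<open>Dirac's theorem on chordal graphs. A component \<open>R\<close> of the non-neighbours of
  \<open>w\<close> is cut off from the rest by the set \<open>S\<close> of its neighbours, and
  \<open>cone\<close> makes \<open>S\<close> a clique. All neighbours of \<open>R\<close> lie in
  \<open>R \<union> S\<close>, so a vertex of \<open>R\<close> that is simplicial there is
  simplicial in \<open>W\<close>. The induction hypothesis is applied to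
  \<open>R \<union> S\<close>.\<close>

lemma ex_simplicial_nonadjacent:
  assumes "finite W" "w \<in> W" "\<not> W \<subseteq> insert w (nbrs W w)"
  shows "\<exists>v. simplicial W v \<and> v \<noteq> w \<and> \<not> adj w v"
  using assms
proof (induction W arbitrary: w rule: finite_psubset_induct)
  case (psubset W)
  define Z where "Z = {z \<in> W. z \<noteq> w \<and> \<not> adj w z}"
  let ?rel = "{(x, y). x \<in> Z \<and> y \<in> Z \<and> adj x y}"
  obtain z0 where z0: "z0 \<in> Z" using psubset.prems by (auto simp: Z_def nbrs_def)
  define R where "R = {z. (z0, z) \<in> ?rel\<^sup>*}"
  define S where "S = {s \<in> nbrs W w. \<exists>r\<in>R. adj s r}"
  have RZ: "R \<subseteq> Z"
  proof
    fix z assume "z \<in> R"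
    then have "(z0, z) \<in> ?rel\<^sup>*" by (simp add: R_def)
    then show "z \<in> Z" by (cases rule: rtranclE) (use z0 in auto)
  qed
  have z0R: "z0 \<in> R" by (simp add: R_def)
  have S_clique: "adj s t" if st: "s \<in> S" "t \<in> S" "s \<noteq> t" for s t
  proof -
    obtain r where r: "r \<in> R" "adj s r" using st by (auto simp: S_def)
    obtain q where q: "q \<in> R" "adj t q" using st by (auto simp: S_def)
    have "(r, q) \<in> ?rel\<^sup>*"
      using r q sym_rtrancl_adj[of z0 r] unfolding R_def by (meson mem_Collect_eq rtrancl_trans)
    then show ?thesis
      using st r q RZ by (intro cone[of w s t Z r q]) (auto simp: S_def nbrs_def Z_def)
  qed
  define W' where "W' = R \<union> S"
  have W'W: "W' \<subset> W"
    using RZ psubset.prems by (auto simp: W'_def S_def Z_def nbrs_def irrefl)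
  have nbrs_R: "nbrs W r \<subseteq> W'" if "r \<in> R" for r
  proof
    fix b assume b: "b \<in> nbrs W r"
    then have "b \<noteq> w" using that RZ sym by (auto simp: nbrs_def Z_def)
    show "b \<in> W'"
    proof (cases "adj w b")
      case True
      then show ?thesis using b that sym by (auto simp: W'_def S_def nbrs_def)
    next
      case False
      then have "(r, b) \<in> ?rel" using b that RZ \<open>b \<noteq> w\<close> by (auto simp: Z_def nbrs_def)
      then have "b \<in> R" using that unfolding R_def by (simp add: rtrancl.rtrancl_into_rtrancl)
      then show ?thesis by (simp add: W'_def)
    qed
  qed
  have lift: "simplicial W r" if "simplicial W' r" "r \<in> R" for r
    using that nbrs_R[of r] W'W unfolding simplicial_def nbrs_def by blast
  have out: "r \<noteq> w \<and> \<not> adj w r" if "r \<in> R" for r using that RZ by (auto simp: Z_def)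
  show ?case
  proof (cases "\<forall>a\<in>W'. \<forall>b\<in>W'. a \<noteq> b \<longrightarrow> adj a b")
    case True
    then have "simplicial W' z0" using z0R by (auto simp: simplicial_def nbrs_def W'_def)
    then show ?thesis using lift out z0R by blast
  next
    case False
    \<comment> \<open>The start vertex of the recursive call must miss some vertex of
      \<open>W'\<close> but see all of \<open>S\<close>: then the simplicial vertex obtained, which
      \<open>z\<close> does not see, has to lie in \<open>R\<close>. If every vertex of
      \<open>S\<close> sees all of \<open>W'\<close>, an end of any missing edge will do.\<close>
    obtain z where z: "z \<in> W'" "\<not> W' \<subseteq> insert z (nbrs W' z)" "\<forall>s\<in>S. s = z \<or> adj z s"
    proof (cases "\<exists>z\<in>S. \<not> W' \<subseteq> insert z (nbrs W' z)")
      case True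
      then show ?thesis using that S_clique unfolding W'_def by blast
    next
      case univ: False
      obtain a b where ab: "a \<in> W'" "b \<in> W'" "a \<noteq> b" "\<not> adj a b" using False by blast
      have "s = a \<or> adj a s" if "s \<in> S" for s
      proof -
        have "a \<in> insert s (nbrs W' s)" using univ that ab by blast
        then show ?thesis using sym by (auto simp: nbrs_def)
      qed
      moreover have "\<not> W' \<subseteq> insert a (nbrs W' a)" using ab by (auto simp: nbrs_def)
      ultimately show ?thesis using that ab by blast
    qed
    from psubset.IH[OF W'W z(1,2)] obtain v where
      v: "simplicial W' v" "v \<noteq> z" "\<not> adj z v" by blast
    then have "v \<in> R" using z(3) by (auto simp: simplicial_def W'_def)
    then show ?thesis using lift out v by blast
  qed
qed

lemma ex_simplicial:
  assumes "finite W" "W \<noteq> {}"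
  shows "\<exists>v. simplicial W v"
proof (cases "\<exists>w\<in>W. \<not> W \<subseteq> insert w (nbrs W w)")
  case True
  then show ?thesis using ex_simplicial_nonadjacent assms by blast
next
  case False
  then have clique: "adj a b" if "a \<in> W" "b \<in> W" "a \<noteq> b" for a b
    using that by (auto simp: nbrs_def subset_iff)
  obtain v where "v \<in> W" using assms by blast
  then have "simplicial W v" using clique by (simp add: simplicial_def nbrs_def)
  then show ?thesis ..
qed

text \<open>
  The depth of a vertex in a perfect elimination ordering: the neighbours preceding a vertex in the
  ordering are exactly those of smaller rank.
\<close>

definition elimination_rank :: "'a set \<Rightarrow> ('a \<Rightarrow> nat) \<Rightarrow> bool" where
  "elimination_rank W d \<longleftrightarrow>
    (\<forall>a\<in>W. \<forall>b\<in>W. adj a b \<longrightarrow> d a \<noteq> d b) \<and>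
    (\<forall>v\<in>W. \<forall>a\<in>W. \<forall>b\<in>W. adj v a \<and> adj v b \<and> a \<noteq> b \<and> d a < d v \<and> d b < d v \<longrightarrow> adj a b) \<and>
    (\<forall>v\<in>W. d v \<noteq> 0 \<longrightarrow> (\<exists>u\<in>W. adj v u \<and> Suc (d u) = d v))"

lemma elimination_rank_neq:
  "elimination_rank W d \<Longrightarrow> a \<in> W \<Longrightarrow> b \<in> W \<Longrightarrow> adj a b \<Longrightarrow> d a \<noteq> d b"
  unfolding elimination_rank_def by blast

lemma elimination_rank_clique:
  "elimination_rank W d \<Longrightarrow> v \<in> W \<Longrightarrow> a \<in> W \<Longrightarrow> b \<in> W \<Longrightarrow> adj v a \<Longrightarrow> adj v b \<Longrightarrow> a \<noteq> b \<Longrightarrow>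
    d a < d v \<Longrightarrow> d b < d v \<Longrightarrow> adj a b"
  unfolding elimination_rank_def by blast

lemma elimination_rank_pred:
  assumes "elimination_rank W d" "v \<in> W" "d v \<noteq> 0"
  shows "\<exists>u\<in>W. adj v u \<and> Suc (d u) = d v"
proof -
  have "\<forall>v\<in>W. d v \<noteq> 0 \<longrightarrow> (\<exists>u\<in>W. adj v u \<and> Suc (d u) = d v)"
    using assms(1) unfolding elimination_rank_def by (elim conjE)
  from bspec[OF this assms(2)] assms(3) show ?thesis by (rule mp)
qed

text \<open>A simplicial vertex is put last, with rank one more than the maximum over its
  neighbours. It is then a lower neighbour of no other vertex, so the clique condition elsewhere is
  unaffected, and the maximum being attained gives the predecessor.\<close>

lemma ex_elimination_rank:
  assumes "finite W"
  shows "\<exists>d. elimination_rank W d"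
  using assms
proof (induction W rule: finite_psubset_induct)
  case (psubset W)
  show ?case
  proof (cases "W = {}")
    case False
    then obtain s where s: "simplicial W s" using ex_simplicial psubset.hyps by blast
    then have "W - {s} \<subset> W" by (auto simp: simplicial_def)
    from psubset.IH[OF this] obtain d where "elimination_rank (W - {s}) d" by blast
    note d1 = elimination_rank_neq[OF this] and d2 = elimination_rank_clique[OF this]
      and d3 = elimination_rank_pred[OF this]
    define m where "m = (if nbrs W s = {} then 0 else Suc (Max (d ` nbrs W s)))"
    have fin: "finite (nbrs W s)" using psubset.hyps by (simp add: nbrs_def)
    have less: "d u < m" if "u \<in> W" "adj s u" for u
    proof -
      have "u \<in> nbrs W s" using that by (simp add: nbrs_def)
      then show ?thesis using fin by (auto simp: m_def less_Suc_eq_le)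
    qed
    have attained: "\<exists>u\<in>W. adj s u \<and> Suc (d u) = m" if "m \<noteq> 0"
    proof -
      have "nbrs W s \<noteq> {}" using that by (auto simp: m_def split: if_splits)
      then have "Max (d ` nbrs W s) \<in> d ` nbrs W s" using fin by simp
      then show ?thesis using \<open>nbrs W s \<noteq> {}\<close> by (auto simp: m_def nbrs_def)
    qed
    define d' where "d' = d(s := m)"
    have [simp]: "d' s = m" and d'[simp]: "v \<noteq> s \<Longrightarrow> d' v = d v" for v by (simp_all add: d'_def)
    show ?thesis unfolding elimination_rank_def
    proof (intro exI[of _ d'] conjI ballI impI)
      fix a b assume "a \<in> W" "b \<in> W" "adj a b"
      then show "d' a \<noteq> d' b"
        using d1[of a b] less[of a] less[of b] irrefl[of s] sym[of a b]
        by (cases "a = s"; cases "b = s") auto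
    next
      fix v a b assume *: "v \<in> W" "a \<in> W" "b \<in> W"
        and **: "adj v a \<and> adj v b \<and> a \<noteq> b \<and> d' a < d' v \<and> d' b < d' v"
      show "adj a b"
      proof (cases "v = s")
        case True
        then show ?thesis using s * ** by (auto simp: simplicial_def nbrs_def)
      next
        case False
        then have "a \<noteq> s" "b \<noteq> s" using less[of v] sym * ** by auto
        then show ?thesis using d2[of v a b] False * ** by simp
      qed
    next
      fix v assume *: "v \<in> W" "d' v \<noteq> 0"
      show "\<exists>u\<in>W. adj v u \<and> Suc (d' u) = d' v"
      proof (cases "v = s")
        case True
        then obtain u where "u \<in> W" "adj s u" "Suc (d u) = m" using attained * by auto
        moreover from this have "u \<noteq> s" using irrefl by blast
        ultimately show ?thesis using True by (intro bexI[of _ u]) auto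
      next
        case False
        then obtain u where "u \<in> W - {s}" "adj v u" "Suc (d u) = d v" using d3[of v] * by auto
        then show ?thesis using False by (intro bexI[of _ u]) auto
      qed
    qed
  qed (simp add: elimination_rank_def)
qed

end

section \<open>Minimal graphs whose square is not colourable\<close>

text \<open>Used to rename the colours on one side of a gluing so that two vertices get prescribed
  colours.\<close>

lemma ex_permutation_two_values:
  fixes a b a' b' :: nat
  assumes "a \<noteq> b" "a' \<noteq> b'" "a < k" "b < k" "a' < k" "b' < k"
  shows "\<exists>\<pi>. inj \<pi> \<and> (\<forall>i<k. \<pi> i < k) \<and> \<pi> a = a' \<and> \<pi> b = b'"
proof -
  \<comment> \<open>\<open>e\<close> is where the first transposition sends \<open>b\<close>. The
    second moves it on to \<open>b'\<close> and fixes \<open>a'\<close>.\<close>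
  define e where "e = Transposition.transpose a a' b"
  have e: "e < k" "e \<noteq> a'" using assms by (auto simp: e_def Transposition.transpose_def)
  show ?thesis
  proof (intro exI conjI)
    let ?\<pi> = "Transposition.transpose e b' \<circ> Transposition.transpose a a'"
    show "inj ?\<pi>" by (intro inj_compose) simp_all
    show "\<forall>i<k. ?\<pi> i < k" using assms e by (auto simp: Transposition.transpose_def)
    show "?\<pi> a = a'" using e assms by (simp add: Transposition.transpose_def)
    show "?\<pi> b = b'" using e by (simp flip: e_def)
  qed
qed

text \<open>The degrees are only bounded by a fixed \<open>k\<close>, instead of \<open>k\<close>
  being tied to the maximum degree of \<open>W\<close>. In this form the hypotheses pass to subsets
  of \<open>W\<close>, so that a counterexample can be taken minimal.\<close>

locale square_critical = chordal_outerplanar_relation adj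
  for adj :: "'a \<Rightarrow> 'a \<Rightarrow> bool" +
  fixes W :: "'a set" and k :: nat
  assumes finite_W: "finite W"
    and degree_less: "v \<in> W \<Longrightarrow> card (nbrs W v) < k"
    and no_F4: "\<lbrakk>k = 5; {a, b, c, x, y, z} \<subseteq> W; distinct [a, b, c, x, y, z]; adj a b; adj b c; adj a c;
      adj x a; adj x b; adj y b; adj y c; adj z a; adj z c\<rbrakk> \<Longrightarrow> False"
    and smaller: "X \<subset> W \<Longrightarrow> \<exists>c. square_colouring X k c"
    and not_colourable: "\<not> square_colouring W k col"
begin

abbreviation N :: "'a \<Rightarrow> 'a set" where
  "N \<equiv> nbrs W"

lemma in_N_iff: "b \<in> N a \<longleftrightarrow> b \<in> W \<and> adj a b"
  by (simp add: nbrs_def)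

lemma N_sym: "a \<in> W \<Longrightarrow> b \<in> N a \<Longrightarrow> a \<in> N b"
  using sym by (simp add: nbrs_def)

lemma finite_N: "finite (N a)"
  using finite_W by (simp add: nbrs_def)

lemma not_in_N_self: "a \<notin> N a"
  using irrefl by (simp add: nbrs_def)

lemma card_closed_nbrs_less: "w \<in> W \<Longrightarrow> v \<in> insert w (N w) \<Longrightarrow> card (insert w (N w) - {v}) < k"
  using degree_less[of w] finite_N[of w] not_in_N_self[of w] by simp

lemma ex_free_colour:
  assumes "finite S" "card S < k"
  shows "\<exists>\<alpha><k. \<alpha> \<notin> c ` S"
proof (rule ccontr)
  assume "\<not> ?thesis"
  then have "card {..<k} \<le> card (c ` S)" using assms by (intro card_mono) auto
  also have "\<dots> \<le> card S" using assms by (intro card_image_le)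
  finally show False using assms by simp
qed

lemma square_colouring_neq:
  "square_colouring X k c \<Longrightarrow> a \<in> X \<Longrightarrow> b \<in> X \<Longrightarrow> a \<noteq> b \<Longrightarrow> adj a b \<Longrightarrow> c a \<noteq> c b"
  unfolding square_colouring_def by blast

lemma square_colouring_neq2:
  "square_colouring X k c \<Longrightarrow> a \<in> X \<Longrightarrow> b \<in> X \<Longrightarrow> a \<noteq> b \<Longrightarrow> z \<in> X \<Longrightarrow> adj a z \<Longrightarrow> adj z b \<Longrightarrow> c a \<noteq> c b"
  unfolding square_colouring_def by blast

lemma square_colouring_less: "square_colouring X k c \<Longrightarrow> a \<in> X \<Longrightarrow> c a < k"
  unfolding square_colouring_def by blast

lemma square_colouring_nbrs_neq:
  assumes "square_colouring X k c" "x \<in> X" "a \<in> X" "b \<in> X" "a \<noteq> b"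
    "a = x \<or> adj x a" "b = x \<or> adj x b"
  shows "c a \<noteq> c b"
  using assms square_colouring_neq[OF assms(1)] square_colouring_neq2[OF assms(1), of a b x]
  by (metis sym)

lemma square_colouringI:
  assumes "\<And>a. a \<in> X \<Longrightarrow> c a < k"
    and "\<And>a b. a \<in> X \<Longrightarrow> b \<in> X \<Longrightarrow> a \<noteq> b \<Longrightarrow> adj a b \<Longrightarrow> c a \<noteq> c b"
    and "\<And>a b z. a \<in> X \<Longrightarrow> b \<in> X \<Longrightarrow> z \<in> X \<Longrightarrow> a \<noteq> b \<Longrightarrow> adj a z \<Longrightarrow> adj z b \<Longrightarrow> c a \<noteq> c b"
  shows "square_colouring X k c"
  unfolding square_colouring_def using assms by blast

text \<open>Two neighbours of a simplicial vertex are adjacent, so removing \<open>v\<close> loses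
  no conflict between other vertices. Only the conflicts of \<open>v\<close> itself remain.\<close>

lemma square_colouring_insert:
  assumes c: "square_colouring (X - {v}) k c" and "v \<in> X" "simplicial X v" "\<alpha> < k"
    and free1: "\<And>b. b \<in> X \<Longrightarrow> b \<noteq> v \<Longrightarrow> adj v b \<Longrightarrow> c b \<noteq> \<alpha>"
    and free2: "\<And>b z. b \<in> X \<Longrightarrow> b \<noteq> v \<Longrightarrow> z \<in> X \<Longrightarrow> adj v z \<Longrightarrow> adj z b \<Longrightarrow> c b \<noteq> \<alpha>"
  shows "square_colouring X k (c(v := \<alpha>))"
proof (rule square_colouringI)
  fix a assume "a \<in> X"
  then show "(c(v := \<alpha>)) a < k" using square_colouring_less[OF c] assms by auto
next
  fix a b assume ab: "a \<in> X" "b \<in> X" "a \<noteq> b" "adj a b"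
  then show "(c(v := \<alpha>)) a \<noteq> (c(v := \<alpha>)) b"
    using square_colouring_neq[OF c, of a b] free1[of a] free1[of b] sym[of a b] by auto
next
  fix a b z assume abz: "a \<in> X" "b \<in> X" "z \<in> X" "a \<noteq> b" "adj a z" "adj z b"
  show "(c(v := \<alpha>)) a \<noteq> (c(v := \<alpha>)) b"
  proof (cases "a = v \<or> b = v")
    case True
    then show ?thesis using abz free2[of a z] free2[of b z] sym[of a z] sym[of z b] by auto
  next
    case False
    have "c a \<noteq> c b"
    proof (cases "z = v")
      case True
      then have "adj a b" using assms(3) abz sym unfolding simplicial_def nbrs_def by blast
      then show ?thesis using False abz square_colouring_neq[OF c, of a b] by blast
    next
      case zv: False
      then show ?thesis using False abz square_colouring_neq2[OF c, of a b z] by blast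
    qed
    then show ?thesis using False by simp
  qed
qed

text \<open>All conflicts of \<open>v\<close> lie in the closed neighbourhood of \<open>w\<close>,
  which without \<open>v\<close> has fewer than \<open>k\<close> elements; hence a colour is left
  for \<open>v\<close>.\<close>

lemma simplicial_not_dominated:
  assumes v: "simplicial W v" and w: "w \<in> W" "v \<in> insert w (N w)"
    and sub: "N v \<subseteq> insert w (N w)" "\<And>n. n \<in> N v \<Longrightarrow> N n \<subseteq> insert w (N w)"
  shows False
proof -
  have vW: "v \<in> W" using v by (simp add: simplicial_def)
  then obtain c where c: "square_colouring (W - {v}) k c" using smaller[of "W - {v}"] by blast
  obtain \<alpha> where \<alpha>: "\<alpha> < k" "\<alpha> \<notin> c ` (insert w (N w) - {v})"
    using ex_free_colour[OF _ card_closed_nbrs_less[OF w]] finite_N by blast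
  have "square_colouring W k (c(v := \<alpha>))"
    using c vW v \<alpha>(1)
  proof (rule square_colouring_insert)
    show "c b \<noteq> \<alpha>" if "b \<in> W" "b \<noteq> v" "adj v b" for b
    proof -
      have "b \<in> N v" using that by (simp add: in_N_iff)
      then show ?thesis using sub that \<alpha>(2) by blast
    qed
    show "c b \<noteq> \<alpha>" if "b \<in> W" "b \<noteq> v" "z \<in> W" "adj v z" "adj z b" for b z
    proof -
      have "z \<in> N v" "b \<in> N z" using that by (simp_all add: in_N_iff)
      then show ?thesis using sub(2)[of z] that \<alpha>(2) by blast
    qed
  qed
  then show False using not_colourable by blast
qed

text \<open>A vertex without neighbours is dominated by itself, one with a single neighbour by that
  neighbour. Three neighbours would form a \<open>K4\<close> with \<open>v\<close>.\<close>

lemma simplicial_nbrs: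
  assumes v: "simplicial W v"
  obtains a b where "N v = {a, b}" "a \<noteq> b" "adj a b"
proof -
  have vW: "v \<in> W" using v by (simp add: simplicial_def)
  have clique: "adj a b" if "a \<in> N v" "b \<in> N v" "a \<noteq> b" for a b
    using v that by (simp add: simplicial_def)
  have "N v \<noteq> {}"
  proof
    assume "N v = {}"
    then show False using simplicial_not_dominated[OF v vW] by auto
  qed
  then obtain a where a: "a \<in> N v" by blast
  have "N v \<noteq> {a}"
  proof
    assume "N v = {a}"
    moreover have "a \<in> W" "v \<in> N a" using a N_sym[OF vW a] by (simp_all add: in_N_iff)
    ultimately show False using simplicial_not_dominated[OF v, of a] by auto
  qed
  then obtain b where b: "b \<in> N v" "b \<noteq> a" using a by blast
  have "N v = {a, b}"
  proof (rule ccontr)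
    assume "N v \<noteq> {a, b}"
    then obtain e where "e \<in> N v" "e \<noteq> a" "e \<noteq> b" using a b by blast
    then show False using no_K4[of v a b e] clique a b by (simp add: in_N_iff)
  qed
  then show ?thesis using that[of a b] clique a b by blast
qed

text \<open>
  Otherwise the edge is a bridge, and colourings of the two sides can be glued after permuting the
  colours of one side.
\<close>

lemma edge_in_triangle:
  assumes "w \<in> W" "t \<in> N w" "b0 \<in> N w" "b0 \<noteq> t"
  shows "\<exists>z\<in>W. adj w z \<and> adj t z"
proof (rule ccontr)
  assume no: "\<not> ?thesis"
  define Z where "Z = {z \<in> W. z \<noteq> w \<and> \<not> adj w z}"
  let ?rel = "{(x, y). x \<in> Z \<and> y \<in> Z \<and> adj x y}"
  \<comment> \<open>\<open>D\<close> is the part of the graph that hangs on \<open>t\<close>. It is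
    attached at \<open>t\<close> only: by \<open>cone\<close>, a neighbour of \<open>w\<close> other
    than \<open>t\<close> with a neighbour in \<open>D\<close> would be adjacent to \<open>t\<close>
    and complete a triangle on the edge.\<close>
  define D where "D = {z. \<exists>a\<in>Z. adj t a \<and> (a, z) \<in> ?rel\<^sup>*}"
  have t: "t \<in> W" "adj w t" "t \<noteq> w" using assms irrefl by (auto simp: in_N_iff)
  have DZ: "D \<subseteq> Z"
  proof
    fix z assume "z \<in> D"
    then obtain a where "a \<in> Z" "(a, z) \<in> ?rel\<^sup>*" by (auto simp: D_def)
    then show "z \<in> Z" by (auto elim: rtranclE)
  qed
  have D_nbrs: "y \<in> D \<or> y = t" if y: "x \<in> D" "y \<in> W" "adj x y" for x y
  proof -
    obtain a where a: "a \<in> Z" "adj t a" "(a, x) \<in> ?rel\<^sup>*" using y by (auto simp: D_def)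
    have x: "x \<in> Z" using y DZ by blast
    then have "y \<noteq> w" using y sym by (auto simp: Z_def)
    show ?thesis
    proof (cases "adj w y")
      case True
      show ?thesis
      proof (rule ccontr)
        assume "\<not> ?thesis"
        then have "adj t y"
          using t a True y sym[of x y] by (intro cone[of w t y Z a x]) (auto simp: Z_def)
        then show False using no True y by blast
      qed
    next
      case False
      then have "(x, y) \<in> ?rel" using x y \<open>y \<noteq> w\<close> by (auto simp: Z_def)
      then show ?thesis using a unfolding D_def by (blast intro: rtrancl.rtrancl_into_rtrancl)
    qed
  qed
  have t_nbrs: "y \<in> D \<or> y = w" if y: "y \<in> W" "adj t y" for y
  proof (cases "adj w y \<or> y = w")
    case True
    then show ?thesis using no y by blast
  next
    case False
    then have "y \<in> Z" using y by (simp add: Z_def)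
    then show ?thesis using y unfolding D_def by blast
  qed
  define V1 where "V1 = insert w (insert t D)"
  define V2 where "V2 = W - insert t D"
  have DW: "D \<subseteq> W" and wD: "w \<notin> D" and tD: "t \<notin> D" using DZ t by (auto simp: Z_def)
  \<comment> \<open>The second neighbour \<open>b0\<close> of \<open>w\<close> keeps
    \<open>V1\<close> a proper subset of \<open>W\<close>.\<close>
  have "b0 \<notin> V1" using assms DZ irrefl by (auto simp: V1_def Z_def in_N_iff)
  then have "V1 \<subset> W" using assms t DW by (auto simp: V1_def in_N_iff)
  then obtain c1 where c1: "square_colouring V1 k c1" using smaller by blast
  have "V2 \<subset> W" using t by (auto simp: V2_def)
  then obtain c2 where c2: "square_colouring V2 k c2" using smaller by blast
  have V: "w \<in> V1" "t \<in> V1" "w \<in> V2" "t \<notin> V2" "W = V1 \<union> V2" "V1 \<inter> V2 = {w}"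
    using assms t DW wD by (auto simp: V1_def V2_def)
  have cross: "x = w \<or> y = w" if "x \<in> V1" "y \<in> V2" "adj x y" for x y
    using that D_nbrs[of x y] t_nbrs[of y] by (auto simp: V1_def V2_def)
  have V1_N: "x = t" if "x \<in> V1" "adj w x" for x
    using that DZ irrefl by (auto simp: V1_def Z_def)
  \<comment> \<open>The sides share only \<open>w\<close>, whose sole neighbour in \<open>V1\<close>
    is \<open>t\<close>. So the only conflicts across are between \<open>t\<close> and the
    neighbours of \<open>w\<close> in \<open>V2\<close>, and it suffices that \<open>t\<close> gets
    a colour \<beta> free around \<open>w\<close>.\<close>
  have card: "card (insert w (N w) - {t}) < k" using card_closed_nbrs_less[of w t] assms by simp
  obtain \<beta> where \<beta>: "\<beta> < k" "\<beta> \<notin> c2 ` (insert w (N w) - {t})"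
    using ex_free_colour[OF _ card] finite_N by blast
  have "c1 w \<noteq> c1 t" using square_colouring_neq[OF c1] V t by blast
  moreover have "c2 w \<noteq> \<beta>" using \<beta> t by blast
  ultimately obtain \<pi> where \<pi>: "inj \<pi>" "\<forall>i<k. \<pi> i < k" "\<pi> (c1 w) = c2 w" "\<pi> (c1 t) = \<beta>"
    using ex_permutation_two_values[of "c1 w" "c1 t" "c2 w" \<beta> k] square_colouring_less[OF c1]
      square_colouring_less[OF c2] V \<beta> by metis
  define c where "c = (\<lambda>x. if x \<in> V1 then \<pi> (c1 x) else c2 x)"
  have c_V1: "c x = \<pi> (c1 x)" if "x \<in> V1" for x using that by (simp add: c_def)
  have c_V2: "c x = c2 x" if "x \<in> V2" for x
    using that V(6) \<pi>(3) by (cases "x \<in> V1") (auto simp: c_def)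
  have inner1: "c a \<noteq> c b" if "c1 a \<noteq> c1 b" "a \<in> V1" "b \<in> V1" for a b
    using that c_V1 \<pi>(1) by (simp add: inj_eq)
  have inner2: "c a \<noteq> c b" if "c2 a \<noteq> c2 b" "a \<in> V2" "b \<in> V2" for a b
    using that c_V2 by simp
  have glued: "c t \<noteq> c b" if "b \<in> V2" "adj w b" for b
  proof -
    have "b \<in> W" "b \<noteq> t" using that V(4,5) by blast+
    then have "b \<in> insert w (N w) - {t}" using that by (simp add: in_N_iff)
    then have "c2 b \<noteq> \<beta>" using \<beta> by blast
    then show ?thesis using c_V1[of t] c_V2[of b] that V(2) \<pi>(4) by simp
  qed
  have "square_colouring W k c"
  proof (rule square_colouringI)
    fix a assume "a \<in> W"
    then consider "a \<in> V1" | "a \<in> V2" using V(5) by blast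
    then show "c a < k"
      by cases (use c_V1[of a] c_V2[of a] \<pi>(2) square_colouring_less[OF c1, of a]
        square_colouring_less[OF c2, of a] in simp_all)
  next
    fix a b assume ab: "a \<in> W" "b \<in> W" "a \<noteq> b" "adj a b"
    then consider "a \<in> V1" "b \<in> V1" | "a \<in> V2" "b \<in> V2"
      using V cross[of a b] cross[of b a] sym[of a b] by blast
    then show "c a \<noteq> c b"
    proof cases
      case 1
      then show ?thesis using ab square_colouring_neq[OF c1, of a b] inner1[of a b] by blast
    next
      case 2
      then show ?thesis using ab square_colouring_neq[OF c2, of a b] inner2[of a b] by blast
    qed
  next
    fix a b z assume abz: "a \<in> W" "b \<in> W" "z \<in> W" "a \<noteq> b" "adj a z" "adj z b"
    have az: "(a \<in> V1 \<and> z \<in> V1) \<or> (a \<in> V2 \<and> z \<in> V2)"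
      using V cross[of a z] cross[of z a] sym[of a z] abz by blast
    have bz: "(b \<in> V1 \<and> z \<in> V1) \<or> (b \<in> V2 \<and> z \<in> V2)"
      using V cross[of b z] cross[of z b] sym[of z b] abz by blast
    have "(a \<in> V1 \<and> b \<in> V1 \<and> z \<in> V1) \<or> (a \<in> V2 \<and> b \<in> V2 \<and> z \<in> V2) \<or>
      z = w \<and> (a \<in> V1 \<and> b \<in> V2 \<or> a \<in> V2 \<and> b \<in> V1)"
      using az bz V by blast
    then show "c a \<noteq> c b"
    proof (elim disjE conjE)
      assume "a \<in> V1" "b \<in> V1" "z \<in> V1"
      then show ?thesis using abz square_colouring_neq2[OF c1, of a b z] inner1[of a b] by blast
    next
      assume "a \<in> V2" "b \<in> V2" "z \<in> V2"
      then show ?thesis using abz square_colouring_neq2[OF c2, of a b z] inner2[of a b] by blast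
    next
      assume "z = w" "a \<in> V1" "b \<in> V2"
      then show ?thesis using abz V1_N[of a] glued[of b] sym[of a w] by blast
    next
      assume "z = w" "a \<in> V2" "b \<in> V1"
      then show ?thesis using abz V1_N[of b] glued[of a] sym[of a w] by metis
    qed
  qed
  then show False using not_colourable by blast
qed

section \<open>Forks and the degrees of their branch vertices\<close>

definition fork :: "'a \<Rightarrow> 'a \<Rightarrow> 'a \<Rightarrow> 'a \<Rightarrow> 'a \<Rightarrow> bool" where
  "fork u w x v v' \<longleftrightarrow> {u, w, x, v, v'} \<subseteq> W \<and> distinct [u, w, x, v, v'] \<and> adj w x \<and>
     N u = {w, x, v, v'} \<and> N v = {u, w} \<and> N v' = {u, x}"

lemma fork_commute: "fork u w x v v' \<Longrightarrow> fork u x w v' v"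
  unfolding fork_def using sym by auto

lemma forkD:
  assumes "fork u w x v v'"
  shows "u \<in> W" "w \<in> W" "x \<in> W" "v \<in> W" "v' \<in> W"
    and "u \<noteq> w" "u \<noteq> x" "u \<noteq> v" "u \<noteq> v'" "w \<noteq> x" "w \<noteq> v" "w \<noteq> v'" "x \<noteq> v" "x \<noteq> v'" "v \<noteq> v'"
    and "N u = {w, x, v, v'}" "N v = {u, w}" "N v' = {u, x}"
    and "adj w x" "adj u w" "adj u x" "adj u v" "adj u v'" "adj v w" "adj v' x"
proof -
  show "u \<in> W" "w \<in> W" "x \<in> W" "v \<in> W" "v' \<in> W"
    and "u \<noteq> w" "u \<noteq> x" "u \<noteq> v" "u \<noteq> v'" "w \<noteq> x" "w \<noteq> v" "w \<noteq> v'" "x \<noteq> v" "x \<noteq> v'" "v \<noteq> v'"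
    and N: "N u = {w, x, v, v'}" "N v = {u, w}" "N v' = {u, x}" and "adj w x"
    using assms by (auto simp: fork_def)
  have "w \<in> N u" "x \<in> N u" "v \<in> N u" "v' \<in> N u" "w \<in> N v" "x \<in> N v'" using N by blast+
  then show "adj u w" "adj u x" "adj u v" "adj u v'" "adj v w" "adj v' x" by (simp_all add: in_N_iff)
qed

text \<open>As \<open>u\<close> has no further neighbours, the coloured vertices in conflict with
  \<open>v\<close> lie in the closed neighbourhood of \<open>w\<close>, and those in conflict with
  \<open>v'\<close> in that of \<open>x\<close>. Apart from these, \<open>v\<close> and
  \<open>v'\<close> conflict only with each other, through \<open>u\<close>.\<close>

lemma fork_no_two_colours:
  assumes f: "fork u w x v v'" and c: "square_colouring (W - {v, v'}) k c"
    and \<alpha>: "\<alpha> < k" "\<alpha> \<notin> c ` (insert w (N w) - {v})"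
    and \<beta>: "\<beta> < k" "\<beta> \<notin> c ` (insert x (N x) - {v'})"
  shows "\<alpha> = \<beta>"
proof (rule ccontr)
  assume ne: "\<alpha> \<noteq> \<beta>"
  note D = forkD[OF f]
  have mem: "u \<in> N x" "w \<in> N x" "u \<in> N w" "x \<in> N w"
    using D(1-3) D(19) sym[OF D(19)] sym[OF D(20)] sym[OF D(21)] by (simp_all add: in_N_iff)
  have *: "W - {v, v'} = (W - {v}) - {v'}" by blast
  have c': "square_colouring (W - {v}) k (c(v' := \<beta>))"
  proof (rule square_colouring_insert)
    show "square_colouring (W - {v} - {v'}) k c" using c by (simp add: *)
    show "v' \<in> W - {v}" using D by blast
    show "simplicial (W - {v}) v'"
    proof -
      have "nbrs (W - {v}) v' \<subseteq> {u, x}" unfolding D(18)[symmetric] nbrs_def by blast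
      then show ?thesis using D(5,15,21) sym[OF D(21)] by (auto simp: simplicial_def)
    qed
    show "\<beta> < k" by fact
    show "c b \<noteq> \<beta>" if "b \<in> W - {v}" "b \<noteq> v'" "adj v' b" for b
    proof -
      have "b \<in> N v'" using that by (simp add: in_N_iff)
      then have "b \<in> insert x (N x) - {v'}" using D(18) mem that(2) by auto
      then show ?thesis using \<beta> by blast
    qed
    show "c b \<noteq> \<beta>" if "b \<in> W - {v}" "b \<noteq> v'" "z \<in> W - {v}" "adj v' z" "adj z b" for b z
    proof -
      have "z \<in> {u, x}" "b \<in> N z" using that D(18) in_N_iff[of z v'] in_N_iff[of b z] by auto
      then have "b = w \<or> b = x \<or> b \<in> N x" using D(16) that(1,2) by auto
      then have "b \<in> insert x (N x) - {v'}" using D(18) mem that(2) by auto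
      then show ?thesis using \<beta> by blast
    qed
  qed
  have "square_colouring W k (c(v' := \<beta>, v := \<alpha>))"
    using c'
  proof (rule square_colouring_insert)
    show "v \<in> W" using D by blast
    show "simplicial W v"
      using D(4,17,20) sym[OF D(20)] by (auto simp: simplicial_def)
    show "\<alpha> < k" by fact
    show "(c(v' := \<beta>)) b \<noteq> \<alpha>" if "b \<in> W" "b \<noteq> v" "adj v b" for b
    proof -
      have "b \<in> N v" using that by (simp add: in_N_iff)
      then have "b \<in> insert w (N w) - {v}" using D(17) mem that(2) by auto
      then show ?thesis using \<alpha> ne by auto
    qed
    show "(c(v' := \<beta>)) b \<noteq> \<alpha>" if "b \<in> W" "b \<noteq> v" "z \<in> W" "adj v z" "adj z b" for b z
    proof (cases "b = v'")
      case False
      have "z \<in> {u, w}" "b \<in> N z" using that D(17) in_N_iff[of z v] in_N_iff[of b z] by auto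
      then have "b = w \<or> b = x \<or> b \<in> N w" using D(16) that(2) False by auto
      then have "b \<in> insert w (N w) - {v}" using D(17) mem that(2) by auto
      then show ?thesis using \<alpha> ne by auto
    qed (use ne in simp)
  qed
  then show False using not_colourable by blast
qed

text \<open>Counting gives a free colour around \<open>w\<close> and one around \<open>x\<close>. By
  \<open>fork_no_two_colours\<close> every free colour of one side equals every free colour of the
  other, so each side has just one and it is the same.\<close>

lemma fork_colours:
  assumes f: "fork u w x v v'" and c: "square_colouring (W - {v, v'}) k c"
  obtains \<alpha> where "\<alpha> < k" "c ` (insert w (N w) - {v}) = {..<k} - {\<alpha>}"
    "c ` (insert x (N x) - {v'}) = {..<k} - {\<alpha>}"
proof -
  note D = forkD[OF f]
  have vN: "v \<in> N w" "v' \<in> N x" using D(4,5) sym[OF D(24)] sym[OF D(25)] by (simp_all add: in_N_iff)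
  have notin: "v' \<notin> insert w (N w)" "v \<notin> insert x (N x)"
    using D(17,18) N_sym[of w v'] N_sym[of x v] D(1-15) by auto
  have sub: "insert w (N w) - {v} \<subseteq> W - {v, v'}" "insert x (N x) - {v'} \<subseteq> W - {v, v'}"
    using notin D(1-5) by (auto simp: in_N_iff)
  have less: "c ` (insert w (N w) - {v}) \<subseteq> {..<k}" "c ` (insert x (N x) - {v'}) \<subseteq> {..<k}"
    using sub square_colouring_less[OF c] by blast+
  obtain \<alpha> where \<alpha>: "\<alpha> < k" "\<alpha> \<notin> c ` (insert w (N w) - {v})"
    using ex_free_colour[of "insert w (N w) - {v}" c] card_closed_nbrs_less[of w v] finite_N[of w]
      vN(1) D(2) by blast
  obtain \<beta> where \<beta>: "\<beta> < k" "\<beta> \<notin> c ` (insert x (N x) - {v'})"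
    using ex_free_colour[of "insert x (N x) - {v'}" c] card_closed_nbrs_less[of x v'] finite_N[of x]
      vN(2) D(3) by blast
  have only_w: "\<gamma> = \<alpha>" if "\<gamma> < k" "\<gamma> \<notin> c ` (insert w (N w) - {v})" for \<gamma>
    using fork_no_two_colours[OF f c that \<beta>] fork_no_two_colours[OF f c \<alpha> \<beta>] by simp
  have only_x: "\<gamma> = \<alpha>" if "\<gamma> < k" "\<gamma> \<notin> c ` (insert x (N x) - {v'})" for \<gamma>
    using fork_no_two_colours[OF f c \<alpha> that] by simp
  have \<alpha>_x: "\<alpha> \<notin> c ` (insert x (N x) - {v'})" using \<beta> only_x[OF \<beta>] by simp
  have "c ` (insert w (N w) - {v}) = {..<k} - {\<alpha>}"
    by (intro equalityI subsetI; use less(1) \<alpha>(2) only_w in blast)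
  moreover have "c ` (insert x (N x) - {v'}) = {..<k} - {\<alpha>}"
    by (intro equalityI subsetI; use less(2) \<alpha>_x only_x in blast)
  ultimately show ?thesis using that \<alpha> by blast
qed

lemma fork_ex_colouring:
  assumes "fork u w x v v'"
  obtains c where "square_colouring (W - {v, v'}) k c"
proof -
  have "W - {v, v'} \<subset> W" using forkD(4)[OF assms] by blast
  then show ?thesis using smaller that by blast
qed

text \<open>The closed neighbourhood of \<open>w\<close> without \<open>v\<close> has as many
  vertices as \<open>N w\<close>, and it must show all \<open>k - 1\<close> colours other than
  \<alpha>.\<close>

lemma fork_degree:
  assumes f: "fork u w x v v'"
  shows "Suc (card (N w)) = k" "Suc (card (N x)) = k"
proof -
  have *: "Suc (card (N w)) = k" if f: "fork u w x v v'" for u w x v v'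
  proof -
    obtain c where c: "square_colouring (W - {v, v'}) k c" using fork_ex_colouring[OF f] by blast
    obtain \<alpha> where \<alpha>: "\<alpha> < k" "c ` (insert w (N w) - {v}) = {..<k} - {\<alpha>}"
      by (rule fork_colours[OF f c])
    have "v \<in> N w" using forkD(4)[OF f] sym[OF forkD(24)[OF f]] by (simp add: in_N_iff)
    then have "card (insert w (N w) - {v}) = card (N w)"
      using finite_N not_in_N_self[of w] by simp
    moreover have "card (c ` (insert w (N w) - {v})) \<le> card (insert w (N w) - {v})"
      using finite_N by (intro card_image_le) simp
    moreover have "card ({..<k} - {\<alpha>}) = k - 1" using \<alpha> by simp
    ultimately have "k - 1 \<le> card (N w)" using \<alpha> by simp
    then show ?thesis using degree_less[of w] forkD(2)[OF f] \<alpha> by linarith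
  qed
  show "Suc (card (N w)) = k" "Suc (card (N x)) = k" using *[OF f] *[OF fork_commute[OF f]] .
qed


lemma fork_not_nbrs:
  assumes f: "fork u w x v v'"
  shows "v \<notin> N x" "v' \<notin> N w"
proof -
  note D = forkD[OF f]
  show "v \<notin> N x" using N_sym[of x v] D(3,7,10,17) by auto
  show "v' \<notin> N w" using N_sym[of w v'] D(2,6,10,18) by auto
qed

text \<open>By \<open>fork_degree\<close> this gives \<open>k \<le> 4\<close>, but \<open>u\<close>
  has degree 4.\<close>

lemma fork_branch_degree_3:
  assumes f: "fork u w x v v'" and Nx: "N x = {w, u, v'}"
  shows False
proof -
  note D = forkD[OF f]
  have "card (N x) \<le> 3" unfolding Nx by (simp add: card_insert_if)
  moreover have "card (N u) = 4" using D(6-16) by simp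
  ultimately show False using fork_degree(2)[OF f] degree_less[OF D(1)] by simp
qed

text \<open>Degree 4 forces \<open>k = 5\<close>, and the triangle \<open>u, w, x\<close> with
  \<open>v\<close>, \<open>y\<close>, \<open>v'\<close> on its three edges is an
  \<open>F_4\<close>.\<close>

lemma fork_branch_degree_4:
  assumes f: "fork u w x v v'" and Nx: "N x = {w, y, u, v'}" and y: "adj w y" "y \<noteq> u" "y \<noteq> v'"
  shows False
proof -
  note D = forkD[OF f]
  have yN: "y \<in> N x" using Nx by blast
  then have yx: "y \<in> W" "adj x y" by (simp_all add: in_N_iff)
  have "y \<noteq> v" using yN fork_not_nbrs[OF f] by blast
  moreover have "y \<noteq> w" "y \<noteq> x" using y yx irrefl by blast+
  ultimately have dist: "distinct [u, w, x, v, y, v']" using D(6-15) y by auto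
  have "card (N x) = 4" unfolding Nx using D(6-15) y \<open>y \<noteq> w\<close> by auto
  then have "k = 5" using fork_degree(2)[OF f] by simp
  then show False
    using no_F4[of u w x v y v'] D(1-5) yx(1) dist D(19-21) D(24,25) sym[OF D(22)] sym[OF D(23)]
      sym[OF y(1)] sym[OF yx(2)] by simp
qed

text \<open>
  By \<open>fork_colours\<close> the fifth neighbour \<open>t\<close> of \<open>w\<close> gets the colour of \<open>r\<close>; but \<open>t\<close> is adjacent to
  \<open>y\<close>, since the edge \<open>wt\<close> lies in a triangle.
\<close>

lemma fork_branch_degree_5:
  assumes f: "fork u w x v v'" and Nx: "N x = {w, y, u, v', r}" and Nr: "N r = {x, y}"
    and y: "adj w y" and dist: "distinct [w, y, u, v', r]"
  shows False
proof -
  note D = forkD[OF f]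
  have "y \<in> N x" "r \<in> N x" using Nx by blast+
  then have yx: "y \<in> W" "adj x y" "r \<in> W" "adj x r" by (simp_all add: in_N_iff)
  have ne: "y \<noteq> v" "r \<noteq> v" "y \<noteq> w" "y \<noteq> x" "r \<noteq> x" "r \<noteq> y"
    using \<open>y \<in> N x\<close> \<open>r \<in> N x\<close> fork_not_nbrs[OF f] dist yx irrefl by auto
  have ry: "adj r y" using Nr in_N_iff[of y r] by blast
  have rw: "r \<notin> N w" using N_sym[of w r] Nr D(2,10) ne by auto
  have "card (N x) = 5" unfolding Nx using dist by simp
  then have "card (N w) = 5" using fork_degree[OF f] by simp
  moreover have sub: "{v, u, x, y} \<subseteq> N w"
    using D(1-4) D(19) yx y sym[OF D(20)] sym[OF D(24)] by (simp add: in_N_iff)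
  moreover have card4: "card {v, u, x, y} = 4" using D(6-15) ne dist by (auto simp: card_insert_if)
  ultimately have "card (N w - {v, u, x, y}) = 1" using finite_N by (simp add: card_Diff_subset)
  then obtain t where "N w - {v, u, x, y} = {t}" by (rule card_1_singletonE)
  then have Nw: "N w = {v, u, x, y, t}" and t: "t \<notin> {v, u, x, y}" using sub by blast+
  have tN: "t \<in> N w" "u \<in> N w" using Nw by blast+
  then have tW: "t \<in> W" "adj w t" by (simp_all add: in_N_iff)
  have "t \<noteq> v'" "t \<noteq> r" "t \<noteq> w" using tN fork_not_nbrs[OF f] rw not_in_N_self by blast+
  \<comment> \<open>The third vertex of a triangle on \<open>{w, t}\<close> is a neighbour of
    \<open>w\<close>. The neighbourhoods of \<open>v\<close>, \<open>u\<close> and \<open>x\<close>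
    are known and omit \<open>t\<close>, so only \<open>y\<close> is left.\<close>
  obtain z where z: "z \<in> W" "adj w z" "adj t z"
    using edge_in_triangle[OF D(2) tN] t by auto
  have "z \<in> N w" "t \<in> N z" using z tW sym[of t z] by (simp_all add: in_N_iff)
  have "z \<noteq> v" "z \<noteq> u" "z \<noteq> x"
    using \<open>t \<in> N z\<close> D(16,17) Nx t \<open>t \<noteq> v'\<close> \<open>t \<noteq> r\<close> \<open>t \<noteq> w\<close> by auto
  moreover have "z \<noteq> t" using z irrefl by blast
  ultimately have "z = y" using \<open>z \<in> N w\<close> Nw by blast
  then have ty: "adj t y" using z by simp
  obtain c where c: "square_colouring (W - {v, v'}) k c" using fork_ex_colouring[OF f] by blast
  obtain \<alpha> where "c ` (insert w (N w) - {v}) = {..<k} - {\<alpha>}"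
    "c ` (insert x (N x) - {v'}) = {..<k} - {\<alpha>}"
    by (rule fork_colours[OF f c])
  then have eq: "c ` (insert w (N w) - {v}) = c ` (insert x (N x) - {v'})" by simp
  have "c t \<in> c ` (insert w (N w) - {v})" using tN t by blast
  then obtain e where e: "e \<in> insert x (N x) - {v'}" "c t = c e" unfolding eq by blast
  have X: "t \<in> W - {v, v'}" "w \<in> W - {v, v'}" "x \<in> W - {v, v'}" "u \<in> W - {v, v'}"
    "y \<in> W - {v, v'}" "r \<in> W - {v, v'}"
    using tW t \<open>t \<noteq> v'\<close> D(1-15) yx ne dist by auto
  have "c t \<noteq> c w" "c t \<noteq> c x" "c t \<noteq> c u" "c t \<noteq> c y"
    using X t \<open>t \<noteq> w\<close> tW(2) D(19) sym[OF D(20)] y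
    by (intro square_colouring_nbrs_neq[OF c X(2)]; auto)+
  moreover have "c t \<noteq> c r"
    using X \<open>t \<noteq> r\<close> sym[OF ty] sym[OF ry] by (intro square_colouring_nbrs_neq[OF c X(5)]; auto)
  ultimately show False using e Nx by auto
qed

text \<open>
  Giving \<open>r'\<close> the missing colour \<open>\<alpha>\<close>, or \<open>\<alpha>\<close> to \<open>u\<close> and the old colour of \<open>u\<close> to \<open>r'\<close>, destroys
  the equality of colour sets forced by \<open>fork_colours\<close>.
\<close>

lemma fork_branch_degree_6:
  assumes f: "fork u w x v v'" and Nx: "N x = {w, y, u, v', r, r'}"
    and f': "fork r x y r' r''"
    and y: "adj w y" and dist: "distinct [w, y, u, v', r, r']"
  shows False
proof -
  note D = forkD[OF f] and D' = forkD[OF f']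
  have ne: "r'' \<noteq> u" "r'' \<noteq> v" "r'' \<noteq> v'" "r \<noteq> v" "r' \<noteq> v" "y \<noteq> v" "x \<noteq> r''" "w \<noteq> r''"
  proof -
    show "r'' \<noteq> u" "r'' \<noteq> v'" using fork_not_nbrs(2)[OF f'] Nx by auto
    show "r \<noteq> v" "r' \<noteq> v" "y \<noteq> v" using fork_not_nbrs(1)[OF f] Nx by auto
    show "r'' \<noteq> v" using D(17) D'(7,8,11,18) D(6) dist by auto
    show "x \<noteq> r''" by (fact D'(12))
    show "w \<noteq> r''" using fork_not_nbrs(2)[OF f'] Nx by auto
  qed
  let ?X = "W - {v, v'}"
  have X: "w \<in> ?X" "x \<in> ?X" "u \<in> ?X" "y \<in> ?X" "r \<in> ?X" "r' \<in> ?X" "r'' \<in> ?X"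
    using D(1-15) D'(1-5) ne dist by auto
  have Xx: "insert x (N x) - {v'} = {x, w, y, u, r, r'}" using Nx D(14) dist by auto
  have r'_w: "r' \<notin> insert w (N w)"
    using D'(2,17,4,11) N_sym[of w r'] D(2,10) dist by auto
  have simp_r': "simplicial ?X r'"
  proof -
    have "nbrs ?X r' \<subseteq> {r, x}" unfolding D'(17)[symmetric] nbrs_def by blast
    then show ?thesis using X D'(20) sym[OF D'(20)] by (auto simp: simplicial_def)
  qed
  have near_r': "b \<in> {x, w, y, u, r, r''}"
    if "b \<in> ?X" "b \<noteq> r'" "adj r' b \<or> (\<exists>z\<in>?X. adj r' z \<and> adj z b)" for b
  proof -
    have "b \<in> N r' \<or> (\<exists>z. z \<in> N r' \<and> b \<in> N z)" using that by (auto simp: in_N_iff)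
    then show ?thesis using D'(16,17) Nx that by auto
  qed
  obtain c where c: "square_colouring ?X k c" using fork_ex_colouring[OF f] by blast
  obtain \<alpha> where \<alpha>: "\<alpha> < k" and cw: "c ` (insert w (N w) - {v}) = {..<k} - {\<alpha>}"
    and cx: "c ` (insert x (N x) - {v'}) = {..<k} - {\<alpha>}"
    by (rule fork_colours[OF f c])
  have notw: "c b \<noteq> \<alpha>" if "b \<in> insert w (N w)" "b \<noteq> v" for b
  proof -
    have "c b \<in> {..<k} - {\<alpha>}" unfolding cw[symmetric] using that by blast
    then show ?thesis by blast
  qed
  have notx: "c b \<noteq> \<alpha>" if "b \<in> {x, w, y, u, r, r'}" for b
  proof -
    have "c b \<in> {..<k} - {\<alpha>}" unfolding cx[symmetric] Xx using that by blast
    then show ?thesis by blast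
  qed
  have c_small: "square_colouring (?X - {r'}) k c"
    using c unfolding square_colouring_def by blast
  show False
  proof (cases "c r'' = \<alpha>")
    case False
    \<comment> \<open>Only \<open>r''\<close> could block \<alpha> at \<open>r'\<close>, because
      everything else near \<open>r'\<close> is in the closed neighbourhood of \<open>x\<close>.
      After the change \<alpha> occurs around \<open>x\<close> but not around \<open>w\<close>, as
      \<open>r'\<close> is neither \<open>w\<close> nor a neighbour of \<open>w\<close>.\<close>
    define c1 where "c1 = c(r' := \<alpha>)"
    have c1: "square_colouring ?X k c1" unfolding c1_def
      using c_small X(6) simp_r' \<alpha>
    proof (rule square_colouring_insert)
      show "c b \<noteq> \<alpha>" if "b \<in> ?X" "b \<noteq> r'" "adj r' b" for b
        using near_r'[of b] that notx[of b] False by blast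
      show "c b \<noteq> \<alpha>" if "b \<in> ?X" "b \<noteq> r'" "z \<in> ?X" "adj r' z" "adj z b" for b z
        using near_r'[of b] that notx[of b] False by blast
    qed
    obtain \<beta> where "c1 ` (insert w (N w) - {v}) = {..<k} - {\<beta>}"
      "c1 ` (insert x (N x) - {v'}) = {..<k} - {\<beta>}"
      by (rule fork_colours[OF f c1])
    then have eq: "c1 ` (insert w (N w) - {v}) = c1 ` (insert x (N x) - {v'})" by simp
    have "c1 r' \<in> c1 ` (insert x (N x) - {v'})" unfolding Xx by blast
    then obtain e where "c1 r' = c1 e" "e \<in> insert w (N w) - {v}"
      unfolding eq[symmetric] by (rule imageE)
    then have e: "e \<in> insert w (N w)" "e \<noteq> v" "c1 e = \<alpha>" by (simp_all add: c1_def)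
    then have "e \<noteq> r'" using r'_w by blast
    then show False using e notw[of e] by (simp add: c1_def)
  next
    case True
    have u_ne: "c u \<noteq> \<alpha>" using notx by blast
    have cu: "c u \<noteq> c b" if "b \<in> {x, w, y, r}" for b
    proof -
      have "u \<noteq> b" "b \<in> ?X" "b = x \<or> adj x b"
        using that dist X D(7) D'(21) sym[OF D(19)] sym[OF D'(20)] D'(19) by auto
      then show ?thesis
        using square_colouring_nbrs_neq[OF c X(2,3), of b] sym[OF D(21)] by blast
    qed
    have r'u: "r' \<noteq> u" using dist by auto
    \<comment> \<open>Now \<open>r''\<close> blocks \<alpha> at \<open>r'\<close>, but \<alpha> is
      free at \<open>u\<close>, whose conflicts outside \<open>{v, v'}\<close> lie around
      \<open>w\<close> and \<open>x\<close>. This releases the old colour of \<open>u\<close> for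
      \<open>r'\<close>; that colour then occurs around \<open>x\<close> and no longer around
      \<open>w\<close>.\<close>
    define c0 where "c0 = c(u := \<alpha>)"
    have c0: "square_colouring (?X - {r'}) k c0"
    proof -
      have simp_u: "simplicial (?X - {r'}) u"
      proof -
        have "nbrs (?X - {r'}) u \<subseteq> {w, x}"
          using D(16) in_N_iff[of _ u] by (auto simp: nbrs_def)
        then show ?thesis
          using X D(19) sym[OF D(19)] r'u unfolding simplicial_def by auto
      qed
      have near_u: "b \<in> insert w (N w) \<union> {x, w, y, u, r, r'}"
        if "b \<in> ?X - {r'}" "b \<noteq> u" "adj u b \<or> (\<exists>z\<in>?X - {r'}. adj u z \<and> adj z b)" for b
      proof -
        have "b \<in> N u \<or> (\<exists>z. z \<in> N u - {v, v'} \<and> b \<in> N z)"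
          using that by (auto simp: in_N_iff)
        then show ?thesis using D(16) Nx that by auto
      qed
      have free: "c b \<noteq> \<alpha>"
        if "b \<in> ?X - {r'}" "b \<noteq> u" "adj u b \<or> (\<exists>z\<in>?X - {r'}. adj u z \<and> adj z b)" for b
        using near_u[OF that] that(1) notw[of b] notx[of b] by blast
      have "square_colouring (?X - {r'} - {u}) k c"
        using c_small unfolding square_colouring_def by blast
      then show ?thesis unfolding c0_def
        using _ simp_u \<alpha>
      proof (rule square_colouring_insert)
        show "u \<in> ?X - {r'}" using X r'u by blast
      qed (use free in blast)+
    qed
    define c2 where "c2 = c0(r' := c u)"
    have c2: "square_colouring ?X k c2" unfolding c2_def
      using c0 X(6) simp_r' square_colouring_less[OF c X(3)]
    proof (rule square_colouring_insert)
      have *: "c0 b \<noteq> c u" if "b \<in> {x, w, y, u, r, r''}" for b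
        using that cu[of b] u_ne True ne by (auto simp: c0_def)
      show "c0 b \<noteq> c u" if "b \<in> ?X" "b \<noteq> r'" "adj r' b" for b
        using near_r'[of b] that *[of b] by blast
      show "c0 b \<noteq> c u" if "b \<in> ?X" "b \<noteq> r'" "z \<in> ?X" "adj r' z" "adj z b" for b z
        using near_r'[of b] that *[of b] by blast
    qed
    obtain \<beta> where "c2 ` (insert w (N w) - {v}) = {..<k} - {\<beta>}"
      "c2 ` (insert x (N x) - {v'}) = {..<k} - {\<beta>}"
      by (rule fork_colours[OF f c2])
    then have eq: "c2 ` (insert w (N w) - {v}) = c2 ` (insert x (N x) - {v'})" by simp
    have "c2 r' \<in> c2 ` (insert x (N x) - {v'})" unfolding Xx by blast
    then obtain e where "c2 r' = c2 e" "e \<in> insert w (N w) - {v}"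
      unfolding eq[symmetric] by (rule imageE)
    then have e: "e \<in> insert w (N w)" "e \<noteq> v" "c2 e = c u" by (simp_all add: c2_def)
    then have er: "e \<noteq> r'" using r'_w by blast
    have eu: "e \<noteq> u" using e u_ne r'u by (auto simp: c2_def c0_def)
    have ce: "c e = c u" using e(3) er eu by (simp add: c2_def c0_def)
    have "e \<noteq> v'" using e(1) fork_not_nbrs(2)[OF f] D(12) by blast
    then have "e \<in> ?X" "e = w \<or> adj w e" using e D(2) by (auto simp: in_N_iff)
    then show False
      using square_colouring_nbrs_neq[OF c X(1), of e u] X eu ce sym[OF D(20)] by blast
  qed
qed

end

section \<open>The three deepest levels of the elimination ordering\<close>

locale square_critical_ranked = square_critical adj W k
  for adj :: "'a \<Rightarrow> 'a \<Rightarrow> bool" and W k +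
  fixes d :: "'a \<Rightarrow> nat" and top :: nat
  assumes rank: "elimination_rank W d"
    and rank_le: "v \<in> W \<Longrightarrow> d v \<le> top"
begin

lemma rank_neq: "a \<in> W \<Longrightarrow> b \<in> N a \<Longrightarrow> d a \<noteq> d b"
  using elimination_rank_neq[OF rank, of a b] by (simp add: in_N_iff)

lemma lower_clique:
  "v \<in> W \<Longrightarrow> a \<in> N v \<Longrightarrow> b \<in> N v \<Longrightarrow> a \<noteq> b \<Longrightarrow> d a < d v \<Longrightarrow> d b < d v \<Longrightarrow> adj a b"
  using elimination_rank_clique[OF rank, of v a b] by (simp add: in_N_iff)

lemma simplicialI: "v \<in> W \<Longrightarrow> (\<And>a. a \<in> N v \<Longrightarrow> d a < d v) \<Longrightarrow> simplicial W v"
  using lower_clique[of v] unfolding simplicial_def by blast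

lemma at_most_two_lower:
  assumes "v \<in> W" "a \<in> N v" "b \<in> N v" "e \<in> N v" "d a < d v" "d b < d v" "d e < d v" "a \<noteq> b"
  shows "e = a \<or> e = b"
proof (rule ccontr)
  assume "\<not> ?thesis"
  then have "adj a b" "adj a e" "adj b e" using lower_clique[OF assms(1)] assms by auto
  then show False using no_K4[of v a b e] assms by (simp add: in_N_iff)
qed

lemma top_nbrs:
  assumes v: "v \<in> W" "d v = top"
  obtains u w where "N v = {u, w}" "Suc (d u) = top" "d w < d u" "adj u w" "u \<in> W" "w \<in> W"
proof -
  have lower: "d a < d v" if "a \<in> N v" for a
    using rank_neq[OF v(1) that] rank_le[of a] that v by (simp add: in_N_iff)
  then have "simplicial W v" using v by (intro simplicialI)
  then obtain a b where ab: "N v = {a, b}" "a \<noteq> b" "adj a b" by (rule simplicial_nbrs)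
  have W: "a \<in> W" "b \<in> W" using ab(1) in_N_iff[of _ v] by auto
  have "d v \<noteq> 0" using lower[of a] ab by simp
  then obtain u where u: "u \<in> W" "adj v u" "Suc (d u) = d v" using elimination_rank_pred[OF rank v(1)] by blast
  then have "u \<in> N v" by (simp add: in_N_iff)
  then consider "u = a" | "u = b" using ab by blast
  then show ?thesis
  proof cases
    case 1
    then have "d b < d a" using u lower[of b] rank_neq[of a b] ab W by (simp add: in_N_iff)
    then show ?thesis using that[of a b] 1 u v ab W by simp
  next
    case 2
    then have "d a < d b" using u lower[of a] rank_neq[of a b] ab W by (simp add: in_N_iff)
    then show ?thesis using that[of b a] 2 u v ab W sym[OF ab(3)] by (simp add: insert_commute)
  qed
qed

text \<open>If \<open>u\<close> has no neighbour of rank \<open>top\<close>, it is simplicial.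
  Otherwise take such a neighbour \<open>v\<close>, on the edge \<open>{u, w}\<close>. As
  \<open>w\<close> does not dominate \<open>v\<close>, some neighbour \<open>z\<close> of
  \<open>u\<close> is missed by \<open>w\<close>. The lower neighbours of \<open>u\<close> form a
  clique, so \<open>z\<close> has rank \<open>top\<close> and sits on another edge
  \<open>{u, x}\<close>. Any further one would put a third triangle on \<open>{u, w}\<close> or
  \<open>{u, x}\<close>.\<close>

lemma second_level_nbrs:
  assumes u: "u \<in> W" "Suc (d u) = top"
  obtains p q where "N u = {p, q}" "p \<noteq> q" "adj p q" "d p < d u" "d q < d u"
  | w x v v' where "fork u w x v v'" "d w < d u" "d x < d u" "d v = top" "d v' = top"
proof -
  have top_or_low: "d z = top \<or> d z < d u" if "z \<in> N u" for z
    using rank_neq[OF u(1) that] rank_le[of z] that u by (auto simp: in_N_iff)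
  have upper: "\<exists>p. N z = {u, p} \<and> p \<in> N u \<and> d p < d u" if z: "z \<in> N u" "d z = top" for z
  proof -
    have zW: "z \<in> W" using z by (simp add: in_N_iff)
    obtain u' p where p: "N z = {u', p}" "Suc (d u') = top" "d p < d u'" "adj u' p" "p \<in> W"
      using top_nbrs[OF zW z(2)] by blast
    have "u \<in> N z" using N_sym[OF u(1) z(1)] .
    then have "u' = u" using p u by auto
    then show ?thesis using p by (auto simp: in_N_iff)
  qed
  show ?thesis
  proof (cases "\<exists>v\<in>N u. d v = top")
    case False
    then have low: "d z < d u" if "z \<in> N u" for z using top_or_low that by blast
    then have "simplicial W u" using u by (intro simplicialI)
    then obtain a b where "N u = {a, b}" "a \<noteq> b" "adj a b" by (rule simplicial_nbrs)
    then show ?thesis using that(1)[of a b] low by simp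
  next
    case True
    then obtain v where v: "v \<in> N u" "d v = top" by blast
    then obtain w where w: "N v = {u, w}" "w \<in> N u" "d w < d u" using upper by blast
    have vW: "v \<in> W" and wW: "w \<in> W" using v w by (simp_all add: in_N_iff)
    have uw: "u \<in> N w" "v \<in> N w" using N_sym[OF u(1) w(2)] N_sym[OF vW, of w] w by simp_all
    have simp_v: "simplicial W v"
      using vW w uw by (auto simp: simplicial_def in_N_iff)
    have not_dom: "\<not> N u \<subseteq> insert w (N w)"
    proof
      assume "N u \<subseteq> insert w (N w)"
      then show False
        using simplicial_not_dominated[OF simp_v wW] uw w(1) by auto
    qed
    then obtain z where z: "z \<in> N u" "z \<noteq> w" "z \<notin> N w" by blast
    have "\<exists>x\<in>N u. d x < d u \<and> x \<noteq> w \<and> (\<exists>v'\<in>N u. d v' = top \<and> N v' = {u, x})"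
    proof -
      have "d z = top"
      proof (rule ccontr)
        assume "d z \<noteq> top"
        then have "d z < d u" using top_or_low z by blast
        then have "adj w z" using lower_clique[of u w z] u w z by blast
        then show False using z by (simp add: in_N_iff)
      qed
      then obtain p where p: "N z = {u, p}" "p \<in> N u" "d p < d u" using upper z by blast
      have "z \<in> N p" using N_sym[of z p] p z by (simp add: in_N_iff)
      then have "p \<noteq> w" using z by blast
      then show ?thesis using p z \<open>d z = top\<close> by blast
    qed
    then obtain x v' where x: "x \<in> N u" "d x < d u" "x \<noteq> w"
      and v': "v' \<in> N u" "d v' = top" "N v' = {u, x}" by blast
    have wx: "adj w x" using lower_clique[of u w x] u w x by blast
    have v'W: "v' \<in> W" and xW: "x \<in> W" using v' x by (simp_all add: in_N_iff)
    have ux: "u \<in> N x" "v' \<in> N x" using N_sym[OF u(1) x(1)] N_sym[OF v'W, of x] v' by simp_all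
    have lev: "d w < top" "d x < top" "d u < top" using w x u by simp_all
    have ne: "u \<noteq> w" "u \<noteq> x" "v \<noteq> v'" "v \<noteq> u" "v \<noteq> w" "v \<noteq> x" "v' \<noteq> u" "v' \<noteq> w" "v' \<noteq> x"
      using w x v v' lev not_in_N_self by (auto simp: doubleton_eq_iff)
    have "N u = {w, x, v, v'}"
    proof (intro equalityI subsetI)
      fix e assume e: "e \<in> N u"
      show "e \<in> {w, x, v, v'}"
      proof (cases "d e = top")
        case False
        then show ?thesis
          using at_most_two_lower[OF u(1) w(2) x(1) e w(3) x(2)] x(3) top_or_low[OF e] by blast
      next
        case True
        then obtain p where p: "N e = {u, p}" "p \<in> N u" "d p < d u" using upper e by blast
        have "e \<in> N p" using N_sym[of e p] p e by (simp add: in_N_iff)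
        have "p = w \<or> p = x"
          using at_most_two_lower[OF u(1) w(2) x(1) p(2) w(3) x(2)] x(3) p(3) by blast
        then show ?thesis
        proof
          assume "p = w"
          then have "e = v \<or> e = x"
            using no_book[of u x w v e] x v e uw wx \<open>e \<in> N p\<close> w(2) ne by (auto simp: in_N_iff)
          then show ?thesis by blast
        next
          assume "p = x"
          then have "e = v' \<or> e = w"
            using no_book[of u w x v' e] w v' e ux wx \<open>e \<in> N p\<close> x(1) ne sym[OF wx]
            by (auto simp: in_N_iff)
          then show ?thesis by blast
        qed
      qed
    qed (use w x v v' in blast)
    then have "fork u w x v v'"
      unfolding fork_def using u vW v'W wW xW ne x(3) wx w(1) v'(3) by auto
    then show ?thesis using that(2) w x v v' by blast
  qed
qed

text \<open>A rank below that of \<open>z\<close> is at most that of \<open>x\<close>, and adjacent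
  vertices differ in rank; so the other lower neighbour \<open>p\<close> of \<open>z\<close> is
  below \<open>x\<close>. Thus \<open>z\<close> sits on an edge from \<open>x\<close> to a lower
  neighbour of \<open>x\<close>, which lets \<open>no_book\<close> bound the number of such
  \<open>z\<close>.\<close>

lemma second_level_nbr_of_third:
  assumes x: "x \<in> W" "Suc (Suc (d x)) = top" and z: "z \<in> N x" "Suc (d z) = top"
  obtains p where "p \<in> N x" "d p < d x" "adj z p" "N z = {x, p}"
  | p a b where "p \<in> N x" "d p < d x" "adj z p" "fork z x p a b" "d a = top" "d b = top"
proof -
  have zW: "z \<in> W" using z by (simp add: in_N_iff)
  have xz: "x \<in> N z" using N_sym x z by blast
  have low: "p \<in> N x \<and> d p < d x \<and> adj z p" if "p \<in> N z" "adj x p" "d p < d z" for p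
  proof -
    have "p \<in> N x" using that by (simp add: in_N_iff)
    then show ?thesis using that rank_neq[OF x(1), of p] x z by (auto simp: in_N_iff)
  qed
  from second_level_nbrs[OF zW z(2)] show ?thesis
  proof cases
    case (1 p q)
    then consider "x = p" | "x = q" using xz by blast
    then show ?thesis
    proof cases
      case 1
      then show ?thesis using low[of q] that(1)[of q] \<open>N z = {p, q}\<close> \<open>adj p q\<close> \<open>d q < d z\<close> by simp
    next
      case 2
      then show ?thesis
        using low[of p] that(1)[of p] \<open>N z = {p, q}\<close> sym[OF \<open>adj p q\<close>] \<open>d p < d z\<close>
        by (simp add: insert_commute)
    qed
  next
    case (2 w' x' v v')
    note D = forkD[OF 2(1)]
    have "x \<noteq> v" "x \<noteq> v'" using x 2 by auto
    then consider "x = w'" | "x = x'" using xz D(16) by blast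
    then show ?thesis
    proof cases
      case 1
      then show ?thesis using low[of x'] that(2)[of x' v v'] 2 D(16,19) by simp
    next
      case 2
      then show ?thesis
        using low[of w'] that(2)[of w' v' v] fork_commute[OF \<open>fork z w' x' v v'\<close>] D(16)
          sym[OF D(19)] \<open>d w' < d z\<close> \<open>d v = top\<close> \<open>d v' = top\<close> by simp
    qed
  qed
qed

lemma top_nbr_of_third:
  assumes x: "x \<in> W" "Suc (Suc (d x)) = top" and z: "z \<in> N x" "d z = top"
  obtains u where "u \<in> N x" "Suc (d u) = top" "N z = {u, x}"
proof -
  have zW: "z \<in> W" using z by (simp add: in_N_iff)
  obtain u w where uw: "N z = {u, w}" "Suc (d u) = top" "d w < d u" "adj u w" "u \<in> W"
    by (rule top_nbrs[OF zW z(2)])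
  have "x \<in> N z" using N_sym x z by blast
  then have "w = x" using uw x by auto
  then show ?thesis using that uw sym[OF uw(4)] by (simp add: in_N_iff)
qed

text \<open>The larger of the two lower ranks at \<open>u\<close> is \<open>d u - 1\<close>, so
  \<open>x\<close> has rank \<open>top - 2\<close>. Its neighbours are at most two lower ones,
  vertices of rank \<open>top - 1\<close> on the edges to these, and vertices of rank
  \<open>top\<close> hanging on the latter. Since an edge carries at most two triangles, only
  neighbourhoods excluded by the \<open>fork_branch_degree\<close> lemmas remain.\<close>

lemma ordered_fork_impossible:
  assumes f: "fork u w x v v'" and lev: "Suc (d u) = top" "d w < d x" "d x < d u"
    "d v = top" "d v' = top"
  shows False
proof -
  note D = forkD[OF f]
  have "\<exists>z\<in>W. adj u z \<and> Suc (d z) = d u" using elimination_rank_pred[OF rank D(1)] lev by simp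
  then obtain z where z: "z \<in> N u" "Suc (d z) = d u" by (auto simp: in_N_iff)
  have "d x = d z"
  proof -
    have "z = w \<or> z = x" using z D(16) lev by auto
    then show ?thesis using z lev by auto
  qed
  then have dx: "Suc (Suc (d x)) = top" using z lev by simp
  have wN: "w \<in> N x" and uN: "u \<in> N x" and v'N: "v' \<in> N x"
    using D(1,2,5) sym[OF D(19)] sym[OF D(21)] sym[OF D(25)] by (simp_all add: in_N_iff)
  have levels: "d e < d x \<or> Suc (d e) = top \<or> d e = top" if "e \<in> N x" for e
    using rank_neq[OF D(3) that] rank_le[of e] that dx by (auto simp: in_N_iff)
  have top_on_u: "e = v'" if e: "e \<in> N x" "N e = {u, x}" for e
  proof -
    have "u \<in> N e" using e by blast
    then have "e \<in> N u" using N_sym[of e u] e by (simp add: in_N_iff)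
    moreover have "e \<noteq> w"
    proof
      assume "e = w"
      moreover have "v \<in> N w" using D(4) sym[OF D(24)] by (simp add: in_N_iff)
      ultimately show False using e(2) D(8,13) by auto
    qed
    moreover have "e \<noteq> v" using e fork_not_nbrs[OF f] by blast
    moreover have "e \<noteq> x" using e not_in_N_self by blast
    ultimately show ?thesis using D(16) by blast
  qed
  show False
  proof (cases "\<exists>y\<in>N x. d y < d x \<and> y \<noteq> w")
    case True
    then obtain y where y: "y \<in> N x" "d y < d x" "y \<noteq> w" by blast
    have wy: "adj w y" using lower_clique[OF D(3) wN y(1)] lev y by blast
    have yW: "y \<in> W" "adj x y" using y by (simp_all add: in_N_iff)
    have y_ne: "y \<noteq> u" "y \<noteq> v'" "y \<noteq> v" using y lev dx by auto
    have low: "e = w \<or> e = y" if "e \<in> N x" "d e < d x" for e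
      using at_most_two_lower[OF D(3) wN y(1) that(1) lev(2) y(2) that(2)] y(3) by blast
    \<comment> \<open>The edge \<open>{x, w}\<close> already carries the triangles with
      \<open>y\<close> and \<open>u\<close>.\<close>
    have on_w: "e = u" if "e \<in> N x" "Suc (d e) = top" "adj e w" for e
    proof (rule ccontr)
      assume "e \<noteq> u"
      moreover have "e \<noteq> y" using that y dx by auto
      ultimately show False
        using no_book[of x y w u e] that(1) yW wy sym[OF that(3)] sym[OF D(19)] sym[OF D(20)]
          sym[OF D(21)] y_ne by (auto simp: in_N_iff)
    qed
    show False
    proof (cases "\<exists>r\<in>N x. Suc (d r) = top \<and> r \<noteq> u")
      case False
      have "N x = {w, y, u, v'}"
      proof (intro equalityI subsetI)
        fix e assume e: "e \<in> N x"
        consider "d e < d x" | "Suc (d e) = top" | "d e = top" using levels[OF e] by blast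
        then show "e \<in> {w, y, u, v'}"
        proof cases
          case 1 then show ?thesis using low[OF e] by blast
        next
          case 2 then show ?thesis using False e by blast
        next
          case 3
          obtain u' where "u' \<in> N x" "Suc (d u') = top" "N e = {u', x}"
            by (rule top_nbr_of_third[OF D(3) dx e 3])
          then show ?thesis using False top_on_u[OF e] by blast
        qed
      qed (use wN y uN v'N in blast)
      then show False using fork_branch_degree_4[OF f _ wy] y_ne by blast
    next
      case True
      then obtain r where r: "r \<in> N x" "Suc (d r) = top" "r \<noteq> u" by blast
      have rW: "r \<in> W" "adj x r" using r by (simp_all add: in_N_iff)
      have r_y: "p = y" if "p \<in> N x" "d p < d x" "adj e p" "e \<in> N x" "Suc (d e) = top" "e \<noteq> u" for e p
        using low[OF that(1,2)] on_w[OF that(4,5)] that(3,6) by blast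
      have ry: "adj r y"
        by (rule second_level_nbr_of_third[OF D(3) dx r(1,2)]) (use r_y r in blast)+
      \<comment> \<open>The edge \<open>{x, y}\<close> already carries the triangles with
        \<open>w\<close> and \<open>r\<close>.\<close>
      have only: "e = u \<or> e = r" if e: "e \<in> N x" "Suc (d e) = top" for e
      proof (rule ccontr)
        assume ne: "\<not> ?thesis"
        have "adj e y"
          by (rule second_level_nbr_of_third[OF D(3) dx e]) (use r_y ne e in blast)+
        moreover have "w \<noteq> r" "w \<noteq> e" using e r lev by auto
        ultimately show False
          using no_book[of x w y r e] wN e r yW ne sym[OF ry] sym[OF wy] sym[of e y]
          by (auto simp: in_N_iff)
      qed
      have r_ne: "r \<noteq> w" "r \<noteq> y" "r \<noteq> v'" using r lev y dx by auto
      have base: "e \<in> {w, y, u, v', r} \<or> d e = top \<and> N e = {r, x}" if e: "e \<in> N x" for e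
      proof -
        consider "d e < d x" | "Suc (d e) = top" | "d e = top" using levels[OF e] by blast
        then show ?thesis
        proof cases
          case 1 then show ?thesis using low[OF e] by blast
        next
          case 2 then show ?thesis using only e by blast
        next
          case 3
          obtain u' where "u' \<in> N x" "Suc (d u') = top" "N e = {u', x}"
            by (rule top_nbr_of_third[OF D(3) dx e 3])
          then show ?thesis using only top_on_u[OF e] 3 by blast
        qed
      qed
      from second_level_nbr_of_third[OF D(3) dx r(1,2)] show False
      proof cases
        case (1 p)
        then have Nr: "N r = {x, y}" using r_y r by blast
        have "N x = {w, y, u, v', r}"
        proof (intro equalityI subsetI)
          fix e assume e: "e \<in> N x"
          have "\<not> (d e = top \<and> N e = {r, x})"
          proof
            assume *: "d e = top \<and> N e = {r, x}"
            then have "e \<in> N r" using N_sym[of e r] e by (simp add: in_N_iff)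
            then show False using Nr * y dx by auto
          qed
          then show "e \<in> {w, y, u, v', r}" using base[OF e] by blast
        qed (use wN y uN v'N r in blast)
        then show False
          using fork_branch_degree_5[OF f _ Nr wy] y y_ne r_ne r(3) D(6,9,12) by auto
      next
        case (2 p a b)
        then have py: "p = y" using r_y r by blast
        note f' = 2(4)[unfolded py]
        note D' = forkD[OF f']
        have aN: "a \<in> N x" using D'(4) sym[OF D'(24)] by (simp add: in_N_iff)
        have "N x = {w, y, u, v', r, a}"
        proof (intro equalityI subsetI)
          fix e assume e: "e \<in> N x"
          have "e = a" if *: "d e = top" "N e = {r, x}"
          proof -
            have "e \<in> N r" using N_sym[of e r] e * by (simp add: in_N_iff)
            moreover have "e \<noteq> b" using * D'(18,10,7) by (auto simp: doubleton_eq_iff)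
            moreover have "e \<noteq> x" "e \<noteq> y" using * y dx by auto
            ultimately show ?thesis using D'(16) by blast
          qed
          then show "e \<in> {w, y, u, v', r, a}" using base[OF e] by blast
        qed (use wN y uN v'N r aN in blast)
        moreover have "a \<noteq> w" "a \<noteq> u" "a \<noteq> v'"
        proof -
          show "a \<noteq> w" "a \<noteq> u" using 2 lev dx by auto
          show "a \<noteq> v'" using D'(17) D(18) r(3) D'(7) by (auto simp: doubleton_eq_iff)
        qed
        ultimately show False
          using fork_branch_degree_6[OF f _ f' wy] y y_ne r_ne r(3) D(6,9,12) D'(8,13) by auto
      qed
    qed
  next
    case False
    then have low: "e = w" if "e \<in> N x" "d e < d x" for e using that by blast
    have second: "adj e w \<and> (N e = {x, w} \<or> (\<exists>a b. fork e x w a b \<and> d a = top \<and> d b = top))"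
      if e: "e \<in> N x" "Suc (d e) = top" for e
      by (rule second_level_nbr_of_third[OF D(3) dx e]) (use low in blast)+
    show False
    proof (cases "\<exists>y\<in>N x. Suc (d y) = top \<and> y \<noteq> u")
      case no_y: False
      have "N x = {w, u, v'}"
      proof (intro equalityI subsetI)
        fix e assume e: "e \<in> N x"
        consider "d e < d x" | "Suc (d e) = top" | "d e = top" using levels[OF e] by blast
        then show "e \<in> {w, u, v'}"
        proof cases
          case 1 then show ?thesis using low[OF e] by blast
        next
          case 2 then show ?thesis using no_y e by blast
        next
          case 3
          obtain u' where "u' \<in> N x" "Suc (d u') = top" "N e = {u', x}"
            by (rule top_nbr_of_third[OF D(3) dx e 3])
          then show ?thesis using no_y top_on_u[OF e] by blast
        qed
      qed (use wN uN v'N in blast)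
      then show False using fork_branch_degree_3[OF f] by blast
    next
      case True
      \<comment> \<open>Without a second lower neighbour of \<open>x\<close>, the role of
        \<open>y\<close> in the branch lemmas passes to a vertex of rank \<open>top - 1\<close> on
        the same edge \<open>{x, w}\<close> as \<open>u\<close>.\<close>
      then obtain y where y: "y \<in> N x" "Suc (d y) = top" "y \<noteq> u" by blast
      have yw: "adj y w" using second[OF y(1,2)] by blast
      have wy: "adj w y" using sym[OF yw] .
      have y_ne: "y \<noteq> w" "y \<noteq> v'" "y \<noteq> x" using y lev dx not_in_N_self by auto
      have only: "e = u \<or> e = y" if e: "e \<in> N x" "Suc (d e) = top" for e
      proof (rule ccontr)
        assume "\<not> ?thesis"
        moreover have "adj w e" using second[OF e] sym by blast
        ultimately show False
          using no_book[of x u w y e] uN y e wy sym[OF D(20)] sym[OF D(19)] by (auto simp: in_N_iff)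
      qed
      have base: "e \<in> {w, y, u, v'} \<or> d e = top \<and> N e = {y, x}" if e: "e \<in> N x" for e
      proof -
        consider "d e < d x" | "Suc (d e) = top" | "d e = top" using levels[OF e] by blast
        then show ?thesis
        proof cases
          case 1 then show ?thesis using low[OF e] by blast
        next
          case 2 then show ?thesis using only e by blast
        next
          case 3
          obtain u' where "u' \<in> N x" "Suc (d u') = top" "N e = {u', x}"
            by (rule top_nbr_of_third[OF D(3) dx e 3])
          then show ?thesis using only top_on_u[OF e] 3 by blast
        qed
      qed
      have in_Ny: "e \<in> N y" if "e \<in> N x" "N e = {y, x}" for e
        using that N_sym[of e y] by (simp add: in_N_iff)
      consider "N y = {x, w}" | a b where "fork y x w a b" "d a = top" "d b = top"
        using second[OF y(1,2)] by blast
      then show False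
      proof cases
        case 1
        have "N x = {w, y, u, v'}"
        proof (intro equalityI subsetI)
          fix e assume e: "e \<in> N x"
          have "\<not> (d e = top \<and> N e = {y, x})" using in_Ny[OF e] 1 lev dx by auto
          then show "e \<in> {w, y, u, v'}" using base[OF e] by blast
        qed (use wN y uN v'N in blast)
        then show False using fork_branch_degree_4[OF f _ wy] y(3) y_ne by blast
      next
        case (2 r b)
        note D' = forkD[OF 2(1)]
        have rN: "r \<in> N x" using D'(4) sym[OF D'(24)] by (simp add: in_N_iff)
        have Nr: "N r = {x, y}" using D'(17) by (simp add: insert_commute)
        have "N x = {w, y, u, v', r}"
        proof (intro equalityI subsetI)
          fix e assume e: "e \<in> N x"
          have "e = r" if *: "d e = top" "N e = {y, x}"
          proof -
            have "e \<noteq> b" using * D'(18,10) y_ne by (auto simp: doubleton_eq_iff)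
            moreover have "e \<noteq> x" "e \<noteq> w" using * lev dx by auto
            ultimately show ?thesis using in_Ny[OF e *(2)] D'(16) by blast
          qed
          then show "e \<in> {w, y, u, v', r}" using base[OF e] by blast
        qed (use wN y uN v'N rN in blast)
        moreover have "r \<noteq> w" "r \<noteq> u" "r \<noteq> y" using 2 lev dx y by auto
        moreover have "r \<noteq> v'" using Nr D(18) y(3) D(7) by (auto simp: doubleton_eq_iff)
        ultimately show False
          using fork_branch_degree_5[OF f _ Nr wy] y_ne y(3) D(6,9,12) by auto
      qed
    qed
  qed
qed

lemma top_not_attained: "v \<in> W \<Longrightarrow> d v \<noteq> top"
proof
  assume v: "v \<in> W" "d v = top"
  obtain u w where u: "N v = {u, w}" "Suc (d u) = top" "u \<in> W"
    by (rule top_nbrs[OF v])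
  have vu: "v \<in> N u" using N_sym[OF v(1), of u] u by simp
  from second_level_nbrs[OF u(3,2)] show False
  proof cases
    case (1 p q)
    then show False using vu v u by auto
  next
    case (2 w x v v')
    have "d w \<noteq> d x" using rank_neq[of w x] forkD(2,3,19)[OF 2(1)] by (simp add: in_N_iff)
    then consider "d w < d x" | "d x < d w" by linarith
    then show False
    proof cases
      case 1
      then show False using ordered_fork_impossible[OF 2(1) u(2)] 2 by blast
    next
      case 2
      then show False
        using ordered_fork_impossible[OF fork_commute[OF \<open>fork u w x v v'\<close>] u(2)]
          \<open>d w < d u\<close> \<open>d v = top\<close> \<open>d v' = top\<close> by blast
    qed
  qed
qed

end

section \<open>Existence of the colouring by induction on the vertex set\<close>

context chordal_outerplanar_relation begin

theorem ex_square_colouring: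
  assumes "finite W" "\<And>v. v \<in> W \<Longrightarrow> card (nbrs W v) < k"
    and "\<And>a b c x y z. \<lbrakk>k = 5; {a, b, c, x, y, z} \<subseteq> W; distinct [a, b, c, x, y, z];
      adj a b; adj b c; adj a c; adj x a; adj x b; adj y b; adj y c; adj z a; adj z c\<rbrakk> \<Longrightarrow> False"
  shows "\<exists>c. square_colouring W k c"
  using assms
proof (induction W rule: finite_psubset_induct)
  case (psubset W)
  show ?case
  proof (rule ccontr)
    assume not: "\<not> ?case"
    have smaller: "\<exists>c. square_colouring X k c" if "X \<subset> W" for X
    proof (rule psubset.IH[OF that])
      fix v assume v: "v \<in> X"
      have "nbrs X v \<subseteq> nbrs W v" using that by (auto simp: nbrs_def)
      then have "card (nbrs X v) \<le> card (nbrs W v)"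
        using psubset.hyps by (intro card_mono) (auto simp: nbrs_def)
      then show "card (nbrs X v) < k" using psubset.prems(1)[of v] v that by fastforce
    next
      fix a b c x y z
      assume *: "k = 5" "{a, b, c, x, y, z} \<subseteq> X" "distinct [a, b, c, x, y, z]"
        "adj a b" "adj b c" "adj a c" "adj x a" "adj x b" "adj y b" "adj y c" "adj z a" "adj z c"
      have "{a, b, c, x, y, z} \<subseteq> W" using *(2) that by blast
      then show False using psubset.prems(2)[OF *(1) _ *(3-)] by blast
    qed
    have "W \<noteq> {}"
    proof
      assume "W = {}"
      then have "square_colouring W k (\<lambda>_. 0)" by (simp add: square_colouring_def)
      then show False using not by blast
    qed
    obtain d where d: "elimination_rank W d" using ex_elimination_rank psubset.hyps by blast
    interpret square_critical_ranked adj W k d "Max (d ` W)"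
    proof unfold_locales
      fix a b c x y z
      assume *: "k = 5" "{a, b, c, x, y, z} \<subseteq> W" "distinct [a, b, c, x, y, z]"
        "adj a b" "adj b c" "adj a c" "adj x a" "adj x b" "adj y b" "adj y c" "adj z a" "adj z c"
      then show False by (rule psubset.prems(2))
    qed (use psubset.hyps psubset.prems smaller not d in auto)
    have "Max (d ` W) \<in> d ` W" using psubset.hyps \<open>W \<noteq> {}\<close> by (intro Max_in) auto
    then obtain v where "v \<in> W" "d v = Max (d ` W)" by auto
    then show False using top_not_attained by blast
  qed
qed

end

section \<open>Graphs given by edge sets\<close>

lemma simple_graph_edge:
  assumes "simple_graph V E" "e \<in> E"
  obtains x y where "e = {x, y}" "x \<noteq> y"
proof -
  have "e \<in> [V]\<^bsup>2\<^esup>" using assms by (auto simp: simple_graph_def)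
  then show ?thesis using that by (auto simp: nsets_2_eq)
qed

lemma rtrancl_restrict_imp_path:
  assumes "(a, b) \<in> {(x, y). x \<in> Z \<and> y \<in> Z \<and> R x y}\<^sup>*" "a \<in> Z"
  shows "\<exists>zs. zs \<noteq> [] \<and> hd zs = a \<and> last zs = b \<and> set zs \<subseteq> Z \<and> successively R zs"
  using assms(1)
proof (induction rule: rtrancl_induct)
  case base
  then show ?case using assms(2) by (intro exI[of _ "[a]"]) simp
next
  case (step y z)
  then obtain zs where "zs \<noteq> []" "hd zs = a" "last zs = y" "set zs \<subseteq> Z" "successively R zs" by blast
  then show ?case using step.hyps(2)
    by (intro exI[of _ "zs @ [z]"]) (auto simp: successively_append_iff)
qed

text \<open>If \<open>{s, t}\<close> is not an edge, a shortest walk from \<open>s\<close> to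
  \<open>t\<close> through \<open>Z\<close> and the vertex \<open>w\<close> form a cycle of length
  at least 4. It has no chord: one between vertices of the walk would shorten the walk, and on the
  walk \<open>w\<close> sees only \<open>s\<close> and \<open>t\<close>.\<close>

lemma chordal_cone:
  assumes graph: "simple_graph V E" and "chordal E"
    and ws: "{w, s} \<in> E" and wt: "{w, t} \<in> E" and st: "s \<noteq> t"
    and Z: "\<forall>z\<in>Z. z \<noteq> w \<and> {w, z} \<notin> E"
    and sa: "{s, a} \<in> E" and tb: "{t, b} \<in> E" and "a \<in> Z"
    and ab: "(a, b) \<in> {(x, y). x \<in> Z \<and> y \<in> Z \<and> {x, y} \<in> E}\<^sup>*"
  shows "{s, t} \<in> E"
proof (rule ccontr)
  assume no: "{s, t} \<notin> E"
  let ?adj = "\<lambda>x y. {x, y} \<in> E"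
  define walk where "walk p \<longleftrightarrow> p \<noteq> [] \<and> hd p = s \<and> last p = t \<and> set p \<subseteq> insert s (insert t Z) \<and>
    successively ?adj p" for p
  obtain zs where zs: "zs \<noteq> []" "hd zs = a" "last zs = b" "set zs \<subseteq> Z" "successively ?adj zs"
    using rtrancl_restrict_imp_path[OF ab \<open>a \<in> Z\<close>] by blast
  then have "walk (s # zs @ [t])"
    using sa tb unfolding walk_def
    by (auto simp: successively_append_iff successively_Cons insert_commute)
  then obtain p where p: "walk p" and p_min: "\<And>q. walk q \<Longrightarrow> length p \<le> length q"
    using ex_has_least_nat[of walk "s # zs @ [t]" length] by blast
  note pD = p[unfolded walk_def]
  \<comment> \<open>Removes the entries strictly between positions \<open>i\<close> and
    \<open>j\<close>. The value \<open>j = length p\<close> stands for cutting off everything after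
    an early visit to \<open>t\<close>; it is needed when a repeated vertex is the last one.\<close>
  have shortcut: False
    if ij: "Suc i < j" "j \<le> length p" "j < length p \<Longrightarrow> ?adj (p ! i) (p ! j)"
      "j = length p \<Longrightarrow> p ! i = t" for i j
  proof -
    define q where "q = take (Suc i) p @ drop j p"
    have i: "Suc i < length p" using ij by simp
    have last_take: "last (take (Suc i) p) = p ! i" using i by (simp add: take_Suc_conv_app_nth)
    have "successively ?adj (take (Suc i) p @ drop (Suc i) p)"
      "successively ?adj (take j p @ drop j p)" using pD by simp_all
    then have "successively ?adj (take (Suc i) p)" "successively ?adj (drop j p)"
      unfolding successively_append_iff by blast+
    then have "successively ?adj q"
      unfolding q_def successively_append_iff using ij last_take
      by (cases "j = length p") (simp_all add: hd_drop_conv_nth)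
    moreover have "q \<noteq> []" "hd q = s" using pD i by (auto simp: q_def hd_append take_Suc)
    moreover have "last q = t"
      using pD ij last_take i by (cases "j = length p") (auto simp: q_def last_append)
    moreover have "set q \<subseteq> insert s (insert t Z)"
      using pD set_take_subset[of "Suc i" p] set_drop_subset[of j p] by (auto simp: q_def)
    ultimately have "walk q" by (simp add: walk_def)
    moreover have "length q < length p" using ij i by (simp add: q_def)
    ultimately show False using p_min[of q] by simp
  qed
  have consecutive: "?adj (p ! i) (p ! Suc i)" if "Suc i < length p" for i
  proof -
    have "successively ?adj (take (Suc i) p @ drop (Suc i) p)" using pD by simp
    then have "?adj (last (take (Suc i) p)) (hd (drop (Suc i) p))"
      unfolding successively_append_iff using that by auto
    then show ?thesis using that by (simp add: take_Suc_conv_app_nth hd_drop_conv_nth)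
  qed
  have last_nth: "p ! (length p - 1) = t" using pD last_conv_nth[of p] by metis
  have hd_nth: "p ! 0 = s" using pD hd_conv_nth[of p] by metis
  have distinct: "distinct p"
  proof -
    have "p ! i \<noteq> p ! j" if ij: "i < j" "j < length p" for i j
    proof
      assume eq: "p ! i = p ! j"
      show False
      proof (rule shortcut[of i "Suc j"])
        show "Suc i < Suc j" "Suc j \<le> length p" using ij by simp_all
        show "?adj (p ! i) (p ! Suc j)" if "Suc j < length p" using consecutive[OF that] eq by simp
        show "p ! i = t" if "Suc j = length p" using last_nth eq that[symmetric] by simp
      qed
    qed
    then show ?thesis by (metis distinct_conv_nth linorder_neqE_nat)
  qed
  have len: "3 \<le> length p"
  proof (rule ccontr)
    assume "\<not> ?thesis"
    moreover have "length p \<noteq> 0" using pD by simp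
    ultimately consider "length p = 1" | "length p = 2" by linarith
    then show False
    proof cases
      case 1
      then show False using pD st by (auto simp: length_Suc_conv)
    next
      case 2
      then have "p ! 0 = s" "p ! 1 = t" using hd_nth last_nth by simp_all
      then show False using consecutive[of 0] 2 no by simp
    qed
  qed
  have w_not: "w \<notin> set p"
  proof -
    have "w \<noteq> s" "w \<noteq> t" using ws wt graph unfolding simple_graph_def
      by (metis doubleton_in_nsets_2 subsetD)+
    then show ?thesis using pD Z by blast
  qed
  define xs where "xs = w # p"
  have edge_in: "{xs ! i, xs ! (Suc i mod length xs)} \<in> cycle_edges xs" if "i < length xs" for i
    using that unfolding cycle_edges_def by blast
  have ends: "{w, s} \<in> cycle_edges xs" "{t, w} \<in> cycle_edges xs"
  proof -
    have "xs ! (Suc 0 mod length xs) = s" using hd_nth pD by (simp add: xs_def)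
    then show "{w, s} \<in> cycle_edges xs" using edge_in[of 0] by (simp add: xs_def)
    have "xs ! length p = t" using last_nth pD by (simp add: xs_def nth_Cons')
    then show "{t, w} \<in> cycle_edges xs" using edge_in[of "length p"] by (simp add: xs_def)
  qed
  have steps: "{p ! i, p ! Suc i} \<in> cycle_edges xs" if "Suc i < length p" for i
    using edge_in[of "Suc i"] that by (simp add: xs_def)
  have "cycle_edges xs \<subseteq> E"
  proof
    fix e assume "e \<in> cycle_edges xs"
    then obtain i where i: "i < length xs" "e = {xs ! i, xs ! (Suc i mod length xs)}"
      by (auto simp: cycle_edges_def)
    consider "i = 0" | "i = length p" "i \<noteq> 0" | j where "i = Suc j" "Suc j < length p"
    proof (cases i)
      case (Suc j)
      then have "Suc j < length p \<or> i = length p" using i(1) by (auto simp: xs_def)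
      then show ?thesis using that(2) that(3)[of j] Suc by (metis nat.distinct(1))
    qed (use that in blast)
    then show "e \<in> E"
    proof cases
      case 1
      then have "e = {w, s}" using i hd_nth pD by (simp add: xs_def)
      then show ?thesis using ws by simp
    next
      case 2
      then have "e = {t, w}" using i last_nth by (simp add: xs_def nth_Cons')
      then show ?thesis using wt by (simp add: insert_commute)
    next
      case 3
      then show ?thesis using i consecutive[of j] by (simp add: xs_def)
    qed
  qed
  then have "graph_cycle E xs" using distinct w_not len by (simp add: graph_cycle_def xs_def)
  moreover have "4 \<le> length xs" using len by (simp add: xs_def)
  ultimately obtain e where e: "e \<in> E" "e \<subseteq> set xs" "e \<notin> cycle_edges xs"
    using \<open>chordal E\<close> unfolding chordal_def by blast
  obtain x y where xy: "e = {x, y}" "x \<noteq> y" by (rule simple_graph_edge[OF graph e(1)])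
  have not_w: "y \<noteq> w" if xy: "e = {x, y}" "x \<noteq> y" for x y
  proof
    assume "y = w"
    then have "x \<in> set p" "{w, x} \<in> E" using e xy by (auto simp: xs_def insert_commute)
    then have "x = s \<or> x = t" using pD Z by blast
    then show False using ends e xy \<open>y = w\<close> by (auto simp: insert_commute)
  qed
  have "x \<in> set p" "y \<in> set p"
    using not_w[of x y] not_w[of y x] xy e(2) by (auto simp: xs_def insert_commute)
  then obtain i j where ij: "i < length p" "j < length p" "x = p ! i" "y = p ! j"
    by (metis in_set_conv_nth)
  have chord: False if "i < j" "j < length p" "e = {p ! i, p ! j}" for i j
  proof (cases "j = Suc i")
    case True
    then show False using steps that e by blast
  next
    case False
    then show False using shortcut[of i j] that e by simp
  qed
  show False
    using chord[of i j] chord[of j i] ij xy by (metis insert_commute linorder_neqE_nat)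
qed

lemma graph_dist_eq_enatD:
  assumes "graph_dist E u v = enat m"
  shows "(u, v) \<in> {(x, y). {x, y} \<in> E} ^^ m"
proof -
  let ?S = "{n. (u, v) \<in> {(x, y). {x, y} \<in> E} ^^ n}"
  \<comment> \<open>An infimum over no lengths would be infinite; a finite distance is therefore
    attained by a walk.\<close>
  have "?S \<noteq> {}"
  proof
    assume "?S = {}"
    then show False using assms unfolding graph_dist_def by (simp add: top_enat_def)
  qed
  then have "Inf (enat ` ?S) \<in> enat ` ?S" unfolding Inf_enat_def by (auto intro: LeastI)
  then show ?thesis using assms unfolding graph_dist_def by auto
qed

lemma graph_dist_le:
  "(u, v) \<in> {(x, y). {x, y} \<in> E} ^^ m \<Longrightarrow> graph_dist E u v \<le> enat m"
  unfolding graph_dist_def by (rule INF_lower) simp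

lemma square_edges_iff:
  "{u, v} \<in> square_edges V E \<longleftrightarrow> u \<in> V \<and> v \<in> V \<and> u \<noteq> v \<and>
     ({u, v} \<in> E \<or> (\<exists>z. {u, z} \<in> E \<and> {z, v} \<in> E))"
proof -
  let ?R = "{(x, y). {x, y} \<in> E}"
  have two: "(a, b) \<in> ?R ^^ 2 \<longleftrightarrow> (\<exists>z. {a, z} \<in> E \<and> {z, b} \<in> E)" for a b
    by (auto simp: numeral_2_eq_2)
  have dist: "graph_dist E a b = 1 \<or> graph_dist E a b = 2 \<longleftrightarrow>
      {a, b} \<in> E \<or> (\<exists>z. {a, z} \<in> E \<and> {z, b} \<in> E)" if "a \<noteq> b" for a b
  proof
    assume "graph_dist E a b = 1 \<or> graph_dist E a b = 2"
    then have "graph_dist E a b = enat 1 \<or> graph_dist E a b = enat 2"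
      by (simp add: one_enat_def numeral_eq_enat)
    then have "(a, b) \<in> ?R ^^ 1 \<or> (a, b) \<in> ?R ^^ 2" using graph_dist_eq_enatD[of E a b 1] graph_dist_eq_enatD[of E a b 2] by blast
    then show "{a, b} \<in> E \<or> (\<exists>z. {a, z} \<in> E \<and> {z, b} \<in> E)" using two by simp
  next
    assume "{a, b} \<in> E \<or> (\<exists>z. {a, z} \<in> E \<and> {z, b} \<in> E)"
    then have "(a, b) \<in> ?R ^^ 1 \<or> (a, b) \<in> ?R ^^ 2" using two by simp
    then have "graph_dist E a b \<le> enat 1 \<or> graph_dist E a b \<le> enat 2" 
      using graph_dist_le[of a b 1 E] graph_dist_le[of a b 2 E] by blast
    then have "graph_dist E a b \<le> enat 2" using order_trans by fastforce
    then obtain m where m: "graph_dist E a b = enat m" "m \<le> 2"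
      by (cases "graph_dist E a b") auto
    have "m \<noteq> 0" using graph_dist_eq_enatD[OF m(1)] that by (cases m) auto
    then have "m = 1 \<or> m = 2" using m(2) by linarith
    then show "graph_dist E a b = 1 \<or> graph_dist E a b = 2"
      using m(1) by (auto simp: one_enat_def numeral_eq_enat)
  qed
  have "{u, v} \<in> square_edges V E \<longleftrightarrow> (\<exists>a b. {u, v} = {a, b} \<and> a \<in> V \<and> b \<in> V \<and> a \<noteq> b \<and>
      ({a, b} \<in> E \<or> (\<exists>z. {a, z} \<in> E \<and> {z, b} \<in> E)))"
    unfolding square_edges_def mem_Collect_eq using dist by (simp cong: conj_cong)
  also have "\<dots> \<longleftrightarrow> u \<in> V \<and> v \<in> V \<and> u \<noteq> v \<and> ({u, v} \<in> E \<or> (\<exists>z. {u, z} \<in> E \<and> {z, v} \<in> E))"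
    (is "?L \<longleftrightarrow> ?R")
  proof
    assume ?L
    then obtain a b where ab: "{u, v} = {a, b}" "a \<in> V" "b \<in> V" "a \<noteq> b"
      "{a, b} \<in> E \<or> (\<exists>z. {a, z} \<in> E \<and> {z, b} \<in> E)" by blast
    then have "u = a \<and> v = b \<or> u = b \<and> v = a" by (simp add: doubleton_eq_iff)
    then show ?R using ab(2-5) by (auto simp: insert_commute)
  next
    assume ?R
    then show ?L by (intro exI[of _ u] exI[of _ v]) simp
  qed
  finally show ?thesis .
qed

lemma clique_card_le_colours:
  assumes "clique K F" "K \<subseteq> V" "proper_colouring V F k c"
  shows "card K \<le> k"
proof -
  have "inj_on c K"
    using assms unfolding inj_on_def clique_def proper_colouring_def by blast
  moreover have "c ` K \<subseteq> {..<k}" using assms unfolding proper_colouring_def by blast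
  ultimately show ?thesis using card_inj_on_le[of c K "{..<k}"] by simp
qed

text \<open>A clique needs as many colours as it has vertices, so one of size \<open>k\<close> and a
  colouring with \<open>k\<close> colours pin down both numbers.\<close>

lemma clique_number_chromatic_number_eqI:
  assumes "finite V" "K \<subseteq> V" "clique K F" "card K = k" "proper_colouring V F k c"
  shows "clique_number V F = k \<and> chromatic_number V F = k"
proof
  have "finite {card K |K. K \<subseteq> V \<and> clique K F}"
    using assms(1) by (auto intro!: finite_image_set)
  then show "clique_number V F = k"
    unfolding clique_number_def
    using assms clique_card_le_colours[OF _ _ assms(5)] by (intro Max_eqI) auto
  show "chromatic_number V F = k"
    unfolding chromatic_number_def
    using assms clique_card_le_colours[OF assms(3,2)] by (intro Least_equality) blast+
qed

theorem theorem4p1: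
  fixes V :: "'a set" and E :: "'a set set" and \<Delta> :: nat
  assumes "simple_graph V E" and "V \<noteq> {}"
    and "chordal E" and "outerplanar V E"
    and "\<Delta> = max_degree V E"
  shows "(\<Delta> = 4 \<and> contains_subgraph V E F4_verts F4_edges \<longrightarrow>
            clique_number V (square_edges V E) = \<Delta> + 2 \<and>
            chromatic_number V (square_edges V E) = \<Delta> + 2) \<and>
         (\<not> (\<Delta> = 4 \<and> contains_subgraph V E F4_verts F4_edges) \<longrightarrow>
            clique_number V (square_edges V E) = \<Delta> + 1 \<and>
            chromatic_number V (square_edges V E) = \<Delta> + 1)"
proof -
  obtain p \<gamma> where "plane_drawing V E p \<gamma>"
    "\<forall>v\<in>V. p v \<in> frontier (outside (drawing_image V E p \<gamma>))"
    using assms(4) unfolding outerplanar_def by blast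
  then interpret D: outerplane_drawing V E p \<gamma>
    using assms(1) by unfold_locales auto
  have finV: "finite V" using assms(1) by (simp add: simple_graph_def)
  let ?adj = "\<lambda>x y. {x, y} \<in> E"
  interpret chordal_outerplanar_relation ?adj
  proof
    show "{b, a} \<in> E" if "{a, b} \<in> E" for a b using that by (simp add: insert_commute)
    show "{a, a} \<notin> E" for a using D.edge_ends[of a a] by blast
    show "{s, t} \<in> E" if "{w, s} \<in> E" "{w, t} \<in> E" "s \<noteq> t" "\<forall>z\<in>Z. z \<noteq> w \<and> {w, z} \<notin> E"
      "{s, a} \<in> E" "{t, b} \<in> E" "a \<in> Z" "(a, b) \<in> {(x, y). x \<in> Z \<and> y \<in> Z \<and> {x, y} \<in> E}\<^sup>*"
      for w s t Z a b using chordal_cone[OF assms(1,3) that] .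
    show False if "{a, b} \<in> E" "{a, c} \<in> E" "{a, d} \<in> E" "{b, c} \<in> E" "{b, d} \<in> E" "{c, d} \<in> E"
      for a b c d using D.no_K4 that by blast
    show False if "{a, x} \<in> E" "{b, x} \<in> E" "{a, y} \<in> E" "{b, y} \<in> E" "{a, z} \<in> E" "{b, z} \<in> E"
      "{a, b} \<in> E" "x \<noteq> y" "x \<noteq> z" "y \<noteq> z" for a x b y z
      using D.no_three_common_neighbours[of a x b y z] D.edge_ends[of a b] that
      by (simp add: insert_commute)
  qed
  have degree: "vertex_degree E v = card (nbrs V v)" if "v \<in> V" for v
  proof -
    have "{e \<in> E. v \<in> e} = (\<lambda>u. {v, u}) ` nbrs V v"
    proof (intro equalityI subsetI)
      fix e assume e: "e \<in> {e \<in> E. v \<in> e}"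
      then obtain x y where "e = {x, y}" using simple_graph_edge[OF assms(1)] by blast
      then obtain u where "e = {v, u}" using e by auto
      then show "e \<in> (\<lambda>u. {v, u}) ` nbrs V v" using e D.edge_ends[of v u] by (auto simp: nbrs_def)
    qed (auto simp: nbrs_def)
    moreover have "inj_on (\<lambda>u. {v, u}) (nbrs V v)" by (auto simp: inj_on_def doubleton_eq_iff)
    ultimately show ?thesis by (simp add: vertex_degree_def card_image)
  qed
  have deg_le: "card (nbrs V v) \<le> \<Delta>" if "v \<in> V" for v
    using finV that degree[OF that] assms(5) by (simp add: max_degree_def flip: degree)
  have "\<Delta> \<in> vertex_degree E ` V"
    unfolding assms(5) max_degree_def using finV assms(2) by (intro Max_in) auto
  then obtain v where v: "v \<in> V" "card (nbrs V v) = \<Delta>" using degree by auto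
  have colouring: "proper_colouring V (square_edges V E) k c" if "square_colouring V k c" for k c
  proof -
    have "c a \<noteq> c b" if ab: "{a, b} \<in> square_edges V E" for a b
    proof -
      have "a \<in> V" "b \<in> V" "a \<noteq> b" "{a, b} \<in> E \<or> (\<exists>z\<in>V. {a, z} \<in> E \<and> {z, b} \<in> E)"
        using ab D.edge_ends unfolding square_edges_iff by blast+
      then show ?thesis using \<open>square_colouring V k c\<close> unfolding square_colouring_def by blast
    qed
    then show ?thesis
      using that by (auto simp: proper_colouring_def square_colouring_def)
  qed
  show ?thesis
  proof (cases "\<Delta> = 4 \<and> contains_subgraph V E F4_verts F4_edges")
    case True
    then obtain h where h: "inj_on h F4_verts" "h ` F4_verts \<subseteq> V" "\<forall>e\<in>F4_edges. h ` e \<in> E"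
      unfolding contains_subgraph_def by blast
    have E: "{h 0, h 1} \<in> E" "{h 1, h 2} \<in> E" "{h 0, h 2} \<in> E" "{h 3, h 0} \<in> E" "{h 3, h 1} \<in> E"
      "{h 4, h 1} \<in> E" "{h 4, h 2} \<in> E" "{h 5, h 0} \<in> E" "{h 5, h 2} \<in> E"
      using h(3) by (simp_all add: F4_edges_def)
    \<comment> \<open>Two vertices of \<open>F_4\<close> that are not adjacent have a common
      neighbour in the triangle.\<close>
    have near: "{h i, h j} \<in> E \<or> (\<exists>z. {h i, z} \<in> E \<and> {z, h j} \<in> E)"
      if "i \<in> F4_verts" "j \<in> F4_verts" "i \<noteq> j" for i j
    proof -
      have E': "{h 1, h 0} \<in> E" "{h 2, h 1} \<in> E" "{h 2, h 0} \<in> E" "{h 0, h 3} \<in> E" "{h 1, h 3} \<in> E"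
        "{h 1, h 4} \<in> E" "{h 2, h 4} \<in> E" "{h 0, h 5} \<in> E" "{h 2, h 5} \<in> E"
        using E by (simp_all add: insert_commute)
      show ?thesis using that E E' unfolding F4_verts_def
        by (elim insertE emptyE) (hypsubst, blast)+
    qed
    have "clique (h ` F4_verts) (square_edges V E)"
      unfolding clique_def square_edges_iff using near h(2) by blast
    moreover have "card (h ` F4_verts) = \<Delta> + 2"
      using True card_image[OF h(1)] by (simp add: F4_verts_def)
    \<comment> \<open>Here there are six colours, so the condition for \<open>k = 5\<close> holds
      vacuously.\<close>
    moreover obtain c where "square_colouring V (\<Delta> + 2) c"
      using ex_square_colouring[OF finV, of "\<Delta> + 2"] deg_le True by fastforce
    ultimately show ?thesis
      using clique_number_chromatic_number_eqI[OF finV h(2)] colouring True by blast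
  next
    case False
    have "clique (insert v (nbrs V v)) (square_edges V E)"
      unfolding clique_def square_edges_iff using v(1) sym by (auto simp: nbrs_def)
    moreover have "card (insert v (nbrs V v)) = \<Delta> + 1"
      using v finV irrefl by (simp add: nbrs_def)
    moreover have "insert v (nbrs V v) \<subseteq> V" using v by (auto simp: nbrs_def)
    moreover obtain c where "square_colouring V (\<Delta> + 1) c"
    proof -
      have "\<exists>c. square_colouring V (\<Delta> + 1) c"
        using finV
      proof (rule ex_square_colouring)
        show "card (nbrs V v) < \<Delta> + 1" if "v \<in> V" for v using deg_le[OF that] by simp
      next
        fix a b c x y z
        assume *: "\<Delta> + 1 = 5" "{a, b, c, x, y, z} \<subseteq> V" "distinct [a, b, c, x, y, z]"
          "{a, b} \<in> E" "{b, c} \<in> E" "{a, c} \<in> E" "{x, a} \<in> E" "{x, b} \<in> E" "{y, b} \<in> E"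
          "{y, c} \<in> E" "{z, a} \<in> E" "{z, c} \<in> E"
        \<comment> \<open>Five colours mean \<open>\<Delta> = 4\<close>, so a copy of
          \<open>F_4\<close> contradicts the case assumption.\<close>
        have "contains_subgraph V E F4_verts F4_edges"
          unfolding contains_subgraph_def
        proof (intro exI conjI)
          let ?h = "\<lambda>i::nat. [a, b, c, x, y, z] ! i"
          have "F4_verts = {..<length [a, b, c, x, y, z]}" by (auto simp: F4_verts_def)
          then show "inj_on ?h F4_verts" using inj_on_nth[OF *(3)] by auto
          show "?h ` F4_verts \<subseteq> V" using *(2) by (simp add: F4_verts_def)
          show "\<forall>e\<in>F4_edges. ?h ` e \<in> E" using *(4-) by (simp add: F4_edges_def)
        qed
        then show False using False * by simp
      qed
      then show ?thesis using that by blast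
    qed
    ultimately show ?thesis
      using clique_number_chromatic_number_eqI[OF finV] colouring False by blast
  qed
qed

end
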